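(* Consider the system of $N$ interacting agents with stochastic interaction matrix $\mathbf{A}=(\alpha_{ij})_{i,j=1}^N$, step sizes $(r_n)_{n\ge 0}$ and vector of agents' states $\mathbf{\bar Z}_n\in\mathbb{R}^N$ at step $n$ described in the context, together with the hierarchical representation of its graph $G=(V,E)$ into classes $R_1,\dots,R_{k_0}$ of level $0$ and classes $T_{m,1},\dots,T_{m,k_m}$ of level $m$, $1\le m\le M$. Assume that agents in a given class all have the same attitude (i.e. they are all cooperative or all competitive). Then $\mathbf{\bar Z}_n\to\mathbf{\bar Z}_\infty$ almost surely, where, writing the vector by blocks corresponding to the classes, $$\mathbf{\bar Z}_\infty=\big((\mathbf{Z}^{(\ell)}_\infty)_{1\le\ell\le k_0};(\mathbf{U}^{(1,h)}_\infty)_{1\le h\le k_1};\dots;(\mathbf{U}^{(M,h)}_\infty)_{1\le h\le k_M}\big)$$ and the blocks are as follows. (a) For $\ell\in\{1,\dots,k_0\}$, if $R_\ell$ is cooperative, then $\mathbf{Z}^{(\ell)}_\infty=(Z^{(\ell)}_\infty,\dots,Z^{(\ell)}_\infty)\in\mathbb{R}^{N_{0,\ell}}$, where $Z^{(\ell)}_\infty$ is a random variable with $P(Z^{(\ell)}_\infty=x)<1$ for all $x\in[0,1]$. (b) If $R_\ell$ is competitive and the subgraph $G_\ell=(R_\ell,E\cap R_\ell^2)$ of $G$ associated to $(\alpha_{ij})_{i,j\in R_\ell}$ is bipartite, then (ordering the agents of $R_\ell$ so that those of one part of the bipartition come first) $\mathbf{Z}^{(\ell)}_\infty=(Z^{(\ell)}_\infty,\dots,Z^{(\ell)}_\infty,1-Z^{(\ell)}_\infty,\dots,1-Z^{(\ell)}_\infty)\in\mathbb{R}^{N_{0,\ell}}$,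 with value $Z^{(\ell)}_\infty$ on one part and $1-Z^{(\ell)}_\infty$ on the other, where $Z^{(\ell)}_\infty$ is a random variable with $P(Z^{(\ell)}_\infty=x)<1$ for all $x\in[0,1]$. (c) If $R_\ell$ is competitive and $G_\ell$ is not bipartite, then $\mathbf{Z}^{(\ell)}_\infty=(\frac12,\dots,\frac12)\in\mathbb{R}^{N_{0,\ell}}$. (d) For $m\in\{1,\dots,M\}$ and $h\in\{1,\dots,k_m\}$, the random variable $\mathbf{U}^{(m,h)}_\infty$ depends on the variables $\mathbf{Z}^{(\ell)}_\infty$, $\ell=1,\dots,k_0$, according to the recursive formula $$\mathbf{U}^{(m,h)}_\infty=-\mathbf{K}_{(m,h)}^{-1}\Big(\mathbf{c}^{(m,h)}+\sum_{\ell=1}^{k_0}\widetilde{\mathbf{B}}^{(0,\ell)}_{(m,h)}\mathbf{Z}^{(\ell)}_\infty+\sum_{t=1}^{m-1}\sum_{s=1}^{k_t}\widetilde{\mathbf{B}}^{(t,s)}_{(m,h)}\mathbf{U}^{(t,s)}_\infty\Big),$$ where, if $T_{m,h}$ is competitive, $$\mathbf{K}_{(m,h)}=2\,\mathrm{diag}(\mathbf{A}_{m,h})-\mathbf{I}_{N_{m,h}}-\mathbf{A}_{m,h},\quad \mathbf{c}^{(m,h)}=(1-\alpha_{ii})_{i\in T_{m,h}},\quad \widetilde{\mathbf{B}}^{(t,s)}_{(m,h)}=-\mathbf{B}^{(t,s)}_{(m,h)},$$ and, if $T_{m,h}$ is cooperative, $$\mathbf{K}_{(m,h)}=\mathbf{A}_{m,h}-\mathbf{I}_{N_{m,h}},\quad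 \mathbf{c}^{(m,h)}=\mathbf{0},\quad \widetilde{\mathbf{B}}^{(t,s)}_{(m,h)}=\mathbf{B}^{(t,s)}_{(m,h)},$$ for $t\in\{0,\dots,m-1\}$ and $s\in\{1,\dots,k_t\}$.
   Context: Model. $\mathbf{A}=(\alpha_{ij})_{i,j=1}^N$ is a stochastic matrix (nonnegative entries, rows summing to $1$), and $(r_n)_{n\ge0}$ is a sequence in $(0,1)$ with $\sum_nr_n=+\infty$, $\sum_nr_n^2<+\infty$. Each agent $i\in V=\{1,\dots,N\}$ is either cooperative or competitive. The states $\bar Z_n(i)\in[0,1]$, $n\ge0$, and the variables $Y_n(i)\in\{0,1\}$ satisfy $$\bar Z_{n+1}(i)=(1-r_n)\bar Z_n(i)+r_nY_{n+1}(i),$$ $$P(Y_{n+1}(i)=1\mid\mathcal{F}_n)=\alpha_{ii}\bar Z_n(i)+\sum_{j\ne i}\alpha_{ij}(1-\bar Z_n(j))\quad\text{if agent } i \text{ is competitive},$$ $$P(Y_{n+1}(i)=1\mid\mathcal{F}_n)=\alpha_{ii}\bar Z_n(i)+\sum_{j\ne i}\alpha_{ij}\bar Z_n(j)\quad\text{if agent } i \text{ is cooperative},$$ where $j$ ranges over all other agents, in whatever class, and $\mathcal{F}_n=\sigma(Y_k;\ k\le n)$. Graph. $G=(V,E)$ is the oriented graph with $(i,j)\in E$ if and only if $i\neq j$ and $\alpha_{ij}\ne0$. Two agents communicate if there are oriented paths from each to the other; a set of communicating agents is a set whose elements pairwise communicate. An oriented graph is bipartite if its vertex set is a disjoint union of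 two nonempty sets such that every edge goes from a vertex of one set to a vertex of the other. Hierarchical representation. A class of level $0$ is a set $R\subset V$ of communicating agents that is closed: $\alpha_{ij}=0$ for all $i\in R$, $j\notin R$. The classes of level $0$ are $R_1,\dots,R_{k_0}$ (also written $T_{0,\ell}=R_\ell$), and $\mathbf{R}=\bigcup_{\ell=1}^{k_0} R_\ell$. A class of level $1$ is a set $T\subset V$ of communicating agents, disjoint from $\mathbf{R}$, such that $\alpha_{ij}=0$ for all $i\in T$ and $j\notin T\cup\mathbf{R}$, and $\alpha_{ij}>0$ for at least one $i\in T$ and $j\in\mathbf{R}$; these classes are $T_{1,1},\dots,T_{1,k_1}$, with union $\mathbf{T_1}$. Inductively, for $m\ge2$, a class of level $m$ is a set $T\subset V$ of communicating agents, disjoint from $\mathbf{R}$ and from $\mathbf{T_1},\dots,\mathbf{T_{m-1}}$, such that $\alpha_{ij}>0$ for at least one $i\in T$ and $j\in\mathbf{T_{m-1}}$, and $\alpha_{ij}=0$ for all $i\in T$ and $j\notin T\cup\mathbf{R}\cup\mathbf{T_1}\cup\dots\cup\mathbf{T_{m-1}}$; these classes are $T_{m,1},\dots,T_{m,k_m}$, with union $\mathbf{T_m}$. The levels are $0,1,\dots,M$; the classes are disjoint and exhaust $V$, and agents are ordered according to levels and classes. Notation. $N_{m,h}=|T_{m,h}|$; $\mathbf{A}_{m,h}=(\alpha_{ij})_{i,j\in T_{m,h}}$; $\mathbf{B}^{(t,s)}_{(m,h)}=(\alpha_{ij})_{i\in T_{m,h},\,j\in T_{t,s}}$ for $0\le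 t<m$; $\mathrm{diag}(\mathbf{A})$ is the diagonal matrix with the same diagonal as $\mathbf{A}$; $\mathbf{I}_k$ is the $k\times k$ identity matrix. $\mathbf{Z}^{(\ell)}_n=(\bar Z_n(i))_{i\in R_\ell}$ and $\mathbf{U}^{(m,h)}_n=(\bar Z_n(i))_{i\in T_{m,h}}$ are the blocks of $\mathbf{\bar Z}_n$, with limits $\mathbf{Z}^{(\ell)}_\infty$ and $\mathbf{U}^{(m,h)}_\infty$.
   Formalization: In (a),(b) the claim P(Z=x)<1 is proved assuming the Y_{n+1}(i) are conditionally independent given F_n and the class does not start a.s. in a fixed absorbing 0/1 configuration; (c) is stated for classes with at least two agents. The claims fail without these. *)

theory Defs
  imports "HOL-Probability.Probability"
begin

text \<open>The agents are the elements of a finite type \<open>'v\<close>, so \<open>N = CARD('v)\<close> and \<open>V = UNIV\<close>; the entry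
  \<open>A $ i $ j\<close> is \<open>\<alpha>\<^sub>i\<^sub>j\<close>. The agents outside the predicate \<open>competitive\<close> are cooperative.\<close>

definition stochastic_matrix :: "real^'v^'v \<Rightarrow> bool" where
  "stochastic_matrix A \<longleftrightarrow> (\<forall>i j. 0 \<le> A $ i $ j) \<and> (\<forall>i. (\<Sum>j\<in>UNIV. A $ i $ j) = 1)"

definition draw_prob :: "real^'v^'v \<Rightarrow> ('v \<Rightarrow> bool) \<Rightarrow> real^'v \<Rightarrow> 'v::finite \<Rightarrow> real" where
  "draw_prob A competitive z i =
     A $ i $ i * z $ i
     + (\<Sum>j\<in>UNIV - {i}. A $ i $ j * (if competitive i then 1 - z $ j else z $ j))"

text \<open>\<open>\<F>\<^sub>n = \<sigma>(Y\<^sub>k; 0 \<le> k \<le> n)\<close>\<close>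
definition history :: "'a measure \<Rightarrow> (nat \<Rightarrow> 'a \<Rightarrow> real^'v) \<Rightarrow> nat \<Rightarrow> 'a measure" where
  "history M Y n =
     sigma (space M) {Y k -` B \<inter> space M | k B. k \<le> n \<and> B \<in> sets borel}"

text \<open>The initial state may be random, and its measurability with respect to \<open>\<F>\<^sub>0\<close> is not required
  separately. No joint law of the draws \<open>Y\<^sub>n\<^sub>+\<^sub>1(i)\<close> given \<open>\<F>\<^sub>n\<close> is prescribed here.\<close>
locale interacting_agents = prob_space M
  for M :: "'a measure"
    and A :: "real^'v^'v"
    and r :: "nat \<Rightarrow> real"
    and competitive :: "'v \<Rightarrow> bool"
    and Zbar Y :: "nat \<Rightarrow> 'a \<Rightarrow> real^'v" +
  assumes stochastic: "stochastic_matrix A"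
    and step_range: "\<And>n. 0 < r n \<and> r n < 1"
    and step_diverges: "filterlim (\<lambda>n. \<Sum>k<n. r k) at_top sequentially"
    and step_square_summable: "summable (\<lambda>n. (r n)\<^sup>2)"
    and Zbar_measurable: "\<And>n. Zbar n \<in> borel_measurable M"
    and Y_measurable: "\<And>n. Y n \<in> borel_measurable M"
    and Zbar_range: "\<And>n i \<omega>. \<omega> \<in> space M \<Longrightarrow> Zbar n \<omega> $ i \<in> {0..1}"
    and Y_range: "\<And>n i \<omega>. \<omega> \<in> space M \<Longrightarrow> Y n \<omega> $ i \<in> {0, 1}"
    and Zbar_Suc: "\<And>n i \<omega>. \<omega> \<in> space M \<Longrightarrow>
          Zbar (Suc n) \<omega> $ i = (1 - r n) * Zbar n \<omega> $ i + r n * Y (Suc n) \<omega> $ i"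
    and Y_cond_prob: "\<And>n i. AE \<omega> in M.
          real_cond_exp M (history M Y n) (indicator {\<omega>' \<in> space M. Y (Suc n) \<omega>' $ i = 1}) \<omega>
            = draw_prob A competitive (Zbar n \<omega>) i"

text \<open>Conditional independence of the family \<open>(Y\<^sub>n\<^sub>+\<^sub>1(i))\<^sub>i\<close> given \<open>\<F>\<^sub>n\<close>, for every \<open>n\<close>\<close>
definition cond_indep_draws :: "'a measure \<Rightarrow> (nat \<Rightarrow> 'a \<Rightarrow> real^'v::finite) \<Rightarrow> bool" where
  "cond_indep_draws M Y \<longleftrightarrow>
     (\<forall>n. \<forall>B :: 'v \<Rightarrow> real set. (\<forall>i. B i \<in> sets borel) \<longrightarrow>
       (AE \<omega> in M.
          real_cond_exp M (history M Y n)
            (indicator {\<omega>' \<in> space M. \<forall>i. Y (Suc n) \<omega>' $ i \<in> B i}) \<omega>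
          = (\<Prod>i\<in>UNIV. real_cond_exp M (history M Y n)
              (indicator {\<omega>' \<in> space M. Y (Suc n) \<omega>' $ i \<in> B i}) \<omega>)))"

text \<open>The agents of \<open>R\<close> start almost surely from a deterministic configuration \<open>z\<close> in which each of them
  draws its own extreme value with probability \<open>1\<close>. If \<open>R\<close> is closed, its states then never change.
  For a closed cooperative class such \<open>z\<close> are the constants \<open>0\<close> and \<open>1\<close>; for a competitive one with a
  bipartition they are the two indicators of the parts.\<close>
definition frozen_start ::
  "'a measure \<Rightarrow> real^'v^'v \<Rightarrow> ('v::finite \<Rightarrow> bool) \<Rightarrow> (nat \<Rightarrow> 'a \<Rightarrow> real^'v) \<Rightarrow> 'v set \<Rightarrow> bool" where
  "frozen_start M A competitive Zbar R \<longleftrightarrow>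
     (\<exists>z. (\<forall>i\<in>R. z $ i \<in> {0, 1} \<and> draw_prob A competitive z i = z $ i)
        \<and> (AE \<omega> in M. \<forall>i\<in>R. Zbar 0 \<omega> $ i = z $ i))"

definition edges :: "real^'v^'v \<Rightarrow> ('v \<times> 'v) set" where
  "edges A = {(i, j). i \<noteq> j \<and> A $ i $ j \<noteq> 0}"

text \<open>Paths of length \<open>0\<close> are allowed, so a single agent is a set of communicating agents.\<close>
definition communicating :: "real^'v^'v \<Rightarrow> 'v set \<Rightarrow> bool" where
  "communicating A S \<longleftrightarrow> (\<forall>i\<in>S. \<forall>j\<in>S. (i, j) \<in> (edges A)\<^sup>*)"

definition bipartition :: "'v set \<Rightarrow> ('v \<times> 'v) set \<Rightarrow> 'v set \<Rightarrow> 'v set \<Rightarrow> bool" where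
  "bipartition V E V1 V2 \<longleftrightarrow>
     V1 \<noteq> {} \<and> V2 \<noteq> {} \<and> V1 \<inter> V2 = {} \<and> V1 \<union> V2 = V
     \<and> (\<forall>(i, j)\<in>E. (i \<in> V1 \<and> j \<in> V2) \<or> (i \<in> V2 \<and> j \<in> V1))"

definition bipartite :: "'v set \<Rightarrow> ('v \<times> 'v) set \<Rightarrow> bool" where
  "bipartite V E \<longleftrightarrow> (\<exists>V1 V2. bipartition V E V1 V2)"

text \<open>The set of all classes of level \<open>m\<close>. It is empty above the highest level of the graph.\<close>
fun level_classes :: "real^'v^'v \<Rightarrow> nat \<Rightarrow> 'v set set" where
  "level_classes A 0 =
     {R. R \<noteq> {} \<and> communicating A R \<and> (\<forall>i\<in>R. \<forall>j. j \<notin> R \<longrightarrow> A $ i $ j = 0)}"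
| "level_classes A (Suc m) =
     {T. communicating A T
       \<and> T \<inter> (\<Union>k\<in>{..m}. \<Union>(level_classes A k)) = {}
       \<and> (\<exists>i\<in>T. \<exists>j\<in>\<Union>(level_classes A m). A $ i $ j > 0)
       \<and> (\<forall>i\<in>T. \<forall>j. j \<notin> T \<union> (\<Union>k\<in>{..m}. \<Union>(level_classes A k)) \<longrightarrow> A $ i $ j = 0)}"

text \<open>Blocks: for \<open>S, T \<subseteq> V\<close> the block of a matrix with rows in \<open>T\<close> and columns in \<open>S\<close> is kept indexed by
  the agents themselves, i.e. only the entries in \<open>T \<times> S\<close> of a \<open>V \<times> V\<close> matrix are ever used.
  Below, \<open>cmp\<close> tells whether the class under consideration is competitive.\<close>

definition diag_part :: "real^'v^'v \<Rightarrow> real^'v^'v" where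
  "diag_part A = (\<chi> i j. if i = j then A $ i $ j else 0)"

definition K_matrix :: "bool \<Rightarrow> real^'v^'v \<Rightarrow> real^'v^'v" where
  "K_matrix cmp A = (if cmp then 2 *\<^sub>R diag_part A - mat 1 - A else A - mat 1)"

definition c_vector :: "bool \<Rightarrow> real^'v^'v \<Rightarrow> real^'v" where
  "c_vector cmp A = (if cmp then (\<chi> i. 1 - A $ i $ i) else 0)"

definition B_tilde :: "bool \<Rightarrow> real^'v^'v \<Rightarrow> real^'v^'v" where
  "B_tilde cmp A = (if cmp then - A else A)"

text \<open>The \<open>T \<times> T\<close> blocks of \<open>K\<close> and \<open>L\<close> are inverse to each other as \<open>|T| \<times> |T|\<close> matrices.\<close>
definition block_inverse :: "'v set \<Rightarrow> real^'v^'v \<Rightarrow> real^'v^'v \<Rightarrow> bool" where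
  "block_inverse T K L \<longleftrightarrow>
     (\<forall>i\<in>T. \<forall>j\<in>T. (\<Sum>k\<in>T. K $ i $ k * L $ k $ j) = (if i = j then 1 else 0)
                  \<and> (\<Sum>k\<in>T. L $ i $ k * K $ k $ j) = (if i = j then 1 else 0))"

text \<open>Component \<open>i\<close> of \<open>B u\<close>, for the block of \<open>B\<close> with columns in \<open>S\<close> and the block of \<open>u\<close> on \<open>S\<close>\<close>
definition block_mult :: "real^'v^'v \<Rightarrow> 'v set \<Rightarrow> real^'v \<Rightarrow> 'v::finite \<Rightarrow> real" where
  "block_mult B S u i = (\<Sum>j\<in>S. B $ i $ j * u $ j)"

end

theory Submission
  imports Defs
begin

text \<open>Centred at \<open>1/2\<close>, the states follow \<open>x\<^sub>n\<^sub>+\<^sub>1 = x\<^sub>n + r\<^sub>n (P x\<^sub>n - x\<^sub>n + \<xi>\<^sub>n)\<close> with \<open>P\<^sub>i\<^sub>j = \<plusminus>\<alpha>\<^sub>i\<^sub>j\<close>, whatever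
  the mix of attitudes. As \<open>|P|\<close> is stochastic, \<open>P\<close> is power bounded. For such \<open>P\<close>, put \<open>K = P - I\<close> and
  \<open>Q = (I + P)/2\<close>: expanding \<open>Q\<^sup>k K\<close> binomially gives \<open>\<parallel>Q\<^sup>k K\<parallel> = O(k\<^sup>-\<^sup>1\<^sup>/\<^sup>2)\<close>, so the space splits into
  \<open>ker K \<oplus> range K\<close>, and \<open>\<Sum>k<N. \<parallel>Q\<^sup>k y\<parallel>\<close> is a Lyapunov function on \<open>range K\<close> for large \<open>N\<close>. The noise is a
  sum of square-summable martingale differences, hence converges, so the whole state vector converges
  almost surely to a fixed point of \<open>z \<mapsto> draw_prob z\<close>, without any recursion over the levels. The shape of
  the limit follows from the maximum principle for the fixed-point equation on each class.

  For a closed class with stationary vector \<open>\<pi>\<close>, the (signed) \<open>\<pi>\<close>-average of \<open>x\<^sub>n\<close> is a martingale. If its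
  limit is constant, all its increments vanish; under conditional independence every single draw is
  then deterministic, which is possible only for a frozen configuration.\<close>

section \<open>Stochastic approximation with a power bounded operator\<close>

text \<open>\<open>P\<close> may be far from symmetric and may be periodic: two cooperative agents
  that listen only to each other give it the eigenvalue -1. So no power of \<open>P\<close> need
  shrink anything, and one step \<open>x + r K x\<close> need not decrease the Euclidean norm.
  Averaging with the identity removes every eigenvalue of modulus 1 except 1 itself, and summing
  norms along the orbit of \<open>Q\<close> makes the eventual decay visible in a single step. Power
  boundedness is all that enters, so neither Jordan forms nor the periods of the classes appear. The
  two premises of the non-degeneracy clause exclude genuine exceptions. Fixing only the marginal law
  of each draw leaves room for cancellation: two cooperative agents with all weights 1/2, both
  started at 1/2 and always drawing opposite values, keep the average 1/2 for ever and converge to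
  the constant 1/2. A frozen start gives a constant limit even with independent draws.\<close>

lemma sum_binomial_Suc:
  fixes g :: "nat \<Rightarrow> 'a::real_vector"
  shows "(\<Sum>j\<le>Suc n. real (Suc n choose j) *\<^sub>R g j)
    = (\<Sum>j\<le>n. real (n choose j) *\<^sub>R (g j + g (Suc j)))"
proof -
  have "(\<Sum>j\<le>n. real (n choose j) *\<^sub>R g j) = (\<Sum>j\<le>Suc n. real (n choose j) *\<^sub>R g j)"
    by simp
  also have "\<dots> = g 0 + (\<Sum>j\<le>n. real (n choose Suc j) *\<^sub>R g (Suc j))"
    by (subst sum.atMost_Suc_shift) simp
  finally show ?thesis
    by (subst sum.atMost_Suc_shift) (simp add: scaleR_add_left scaleR_add_right sum.distrib)
qed

text \<open>\<open>2 j - n\<close> is a sum of \<open>n\<close> signs of which \<open>j\<close> are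
  positive, so this is its second moment \<open>n\<close> before division by \<open>2^n\<close>. By
  Pascal's rule each step replaces \<open>t^2\<close> by
  \<open>(t - 1)^2 + (t + 1)^2 = 2 t^2 + 2\<close>.\<close>

lemma sum_binomial_variance:
  "(\<Sum>j\<le>n. real (n choose j) * (2 * real j - real n)\<^sup>2) = real n * 2 ^ n"
proof (induction n)
  case (Suc n)
  have "(\<Sum>j\<le>Suc n. real (Suc n choose j) * (2 * real j - real (Suc n))\<^sup>2)
    = (\<Sum>j\<le>n. real (n choose j) * ((2 * real j - real (Suc n))\<^sup>2 + (2 * real (Suc j) - real (Suc n))\<^sup>2))"
    using sum_binomial_Suc[of n "\<lambda>j. (2 * real j - real (Suc n))\<^sup>2"] by simp
  also have "\<dots> = (\<Sum>j\<le>n. 2 * (real (n choose j) * (2 * real j - real n)\<^sup>2) + 2 * real (n choose j))"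
    by (intro sum.cong) (auto simp: power2_eq_square algebra_simps)
  also have "\<dots> = 2 * (real n * 2 ^ n) + 2 * real (\<Sum>j\<le>n. n choose j)"
    by (simp add: sum.distrib sum_distrib_left[symmetric] Suc.IH)
  also have "(\<Sum>j\<le>n. n choose j) = 2 ^ n"
    by (rule choose_row_sum)
  finally show ?case by (simp add: algebra_simps)
qed simp

text \<open>Cauchy-Schwarz against the variance, in the pointwise form
  \<open>|t| \<le> t^2 / (2 s) + s / 2\<close>; the choice \<open>s = sqrt n\<close> makes the two
  resulting terms equal.\<close>

lemma sum_binomial_abs_deviation:
  assumes "n > 0"
  shows "(\<Sum>j\<le>n. real (n choose j) * \<bar>2 * real j - real n\<bar>) \<le> sqrt (real n) * 2 ^ n"
proof -
  define s where "s = sqrt (real n)"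
  have s: "s > 0" "s * s = real n" using assms by (auto simp: s_def)
  have "\<bar>t\<bar> \<le> t\<^sup>2 / (2 * s) + s / 2" for t
  proof -
    have "0 \<le> (\<bar>t\<bar> - s)\<^sup>2 / (2 * s)" using s by auto
    also have "\<dots> = t\<^sup>2 / (2 * s) + s / 2 - \<bar>t\<bar>"
      using s(1) by (simp add: power2_eq_square field_simps)
    finally show ?thesis by simp
  qed
  then have "(\<Sum>j\<le>n. real (n choose j) * \<bar>2 * real j - real n\<bar>)
      \<le> (\<Sum>j\<le>n. real (n choose j) * ((2 * real j - real n)\<^sup>2 / (2 * s) + s / 2))"
    by (intro sum_mono mult_left_mono) auto
  also have "\<dots> = (\<Sum>j\<le>n. real (n choose j) * (2 * real j - real n)\<^sup>2) / (2 * s)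
      + real (\<Sum>j\<le>n. n choose j) * (s / 2)"
    by (simp add: ring_distribs sum.distrib sum_divide_distrib sum_distrib_right)
  also have "\<dots> = s * 2 ^ n"
    using s(1) unfolding sum_binomial_variance choose_row_sum
    by (simp add: field_simps s(2)[symmetric])
  finally show ?thesis by (simp add: s_def)
qed

text \<open>Summation by parts: \<open>g j\<close> acquires the coefficient
  \<open>(k choose (j - 1)) - (k choose j)\<close>, which is
  \<open>(2 j - (k + 1)) / (k + 1)\<close> times \<open>Suc k choose j\<close>. The factor
  \<open>Suc k\<close> clears that denominator.\<close>

lemma sum_binomial_diff:
  fixes g :: "nat \<Rightarrow> 'a::real_vector"
  shows "real (Suc k) *\<^sub>R (\<Sum>j\<le>k. real (k choose j) *\<^sub>R (g (Suc j) - g j))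
    = (\<Sum>j\<le>Suc k. (real (Suc k choose j) * (2 * real j - real (Suc k))) *\<^sub>R g j)"
proof -
  have 1: "real (Suc k) * real (k choose j) = real (Suc j) * real (Suc k choose Suc j)" for j
    by (metis Suc_times_binomial_eq mult.commute of_nat_mult)
  have 2: "real (Suc k) * real (k choose j) = (real (Suc k) - real j) * real (Suc k choose j)"
    if "j \<le> k" for j
  proof -
    have "(Suc k - j) * (Suc k choose j) = Suc k * (k choose j)"
      using binomial_absorb_comp[of "Suc k" j] by simp
    then have "real (Suc k) * real (k choose j) = real (Suc k - j) * real (Suc k choose j)"
      by (metis of_nat_mult)
    then show ?thesis using that by (simp add: of_nat_diff)
  qed
  have "real (Suc k) *\<^sub>R (\<Sum>j\<le>k. real (k choose j) *\<^sub>R (g (Suc j) - g j))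
    = (\<Sum>j\<le>k. (real (Suc k) * real (k choose j)) *\<^sub>R g (Suc j))
      - (\<Sum>j\<le>k. (real (Suc k) * real (k choose j)) *\<^sub>R g j)"
    by (simp add: scaleR_sum_right sum_subtractf scaleR_diff_right del: of_nat_Suc)
  also have "(\<Sum>j\<le>k. (real (Suc k) * real (k choose j)) *\<^sub>R g (Suc j))
      = (\<Sum>j\<le>Suc k. (real j * real (Suc k choose j)) *\<^sub>R g j)"
    unfolding 1 by (subst sum.atMost_Suc_shift) simp
  also have "(\<Sum>j\<le>k. (real (Suc k) * real (k choose j)) *\<^sub>R g j)
      = (\<Sum>j\<le>Suc k. ((real (Suc k) - real j) * real (Suc k choose j)) *\<^sub>R g j)"
    using 2 by simp
  finally show ?thesis
    by (simp only: sum_subtractf[symmetric] scaleR_left_diff_distrib[symmetric])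
       (intro sum.cong refl arg_cong2[where f=scaleR], simp add: algebra_simps)
qed

text \<open>A discrete Gronwall argument: once \<open>\<epsilon> n < c * d\<close>, the part of
  \<open>v\<close> above the level \<open>d\<close> shrinks by the factor \<open>1 - c * r n\<close>
  in each step, and divergence of the sum of \<open>r\<close> drives the product of these factors to
  0.\<close>

lemma perturbed_contraction_tendsto_0:
  fixes v r \<epsilon> :: "nat \<Rightarrow> real"
  assumes c: "c > 0"
    and v: "\<And>n. 0 \<le> v n"
    and r: "\<And>n. 0 \<le> r n" "r \<longlonglongrightarrow> 0" "filterlim (\<lambda>n. \<Sum>k<n. r k) at_top sequentially"
    and \<epsilon>: "\<epsilon> \<longlonglongrightarrow> 0"
    and step: "\<forall>\<^sub>F n in sequentially. v (Suc n) \<le> (1 - c * r n) * v n + r n * \<epsilon> n"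
  shows "v \<longlonglongrightarrow> 0"
proof (rule LIMSEQ_I)
  fix \<delta> :: real assume "\<delta> > 0"
  define d where "d = \<delta> / 2"
  have d: "d > 0" using \<open>\<delta> > 0\<close> by (simp add: d_def)
  have "\<forall>\<^sub>F n in sequentially. \<epsilon> n < c * d"
    using \<epsilon> c d by (intro order_tendstoD) auto
  moreover have "\<forall>\<^sub>F n in sequentially. r n < 1 / c"
    using r(2) c by (intro order_tendstoD) auto
  ultimately have "\<forall>\<^sub>F n in sequentially. v (Suc n) \<le> (1 - c * r n) * v n + r n * \<epsilon> n
      \<and> \<epsilon> n < c * d \<and> r n < 1 / c"
    using step by eventually_elim auto
  then obtain m where m: "\<And>n. n \<ge> m \<Longrightarrow> v (Suc n) \<le> (1 - c * r n) * v n + r n * \<epsilon> n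
      \<and> \<epsilon> n < c * d \<and> r n < 1 / c"
    unfolding eventually_sequentially by auto
  \<comment> \<open>The excess is cut at 0: below the level \<open>d\<close> the recursion only
    ensures that \<open>v\<close> does not rise above it.\<close>
  define u where "u n = max 0 (v n - d)" for n
  have u_step: "u (Suc n) \<le> exp (- c * r n) * u n" if "n \<ge> m" for n
  proof -
    have rn: "c * r n < 1" using m[OF that] c by (simp add: field_simps)
    have "v (Suc n) - d \<le> (1 - c * r n) * v n + r n * (c * d) - d"
      using m[OF that] r(1)[of n] by (smt (verit) mult_left_mono)
    also have "\<dots> = (1 - c * r n) * (v n - d)" by (simp add: algebra_simps)
    also have "\<dots> \<le> (1 - c * r n) * u n" using rn by (intro mult_left_mono) (auto simp: u_def)
    also have "\<dots> \<le> exp (- c * r n) * u n"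
      using exp_ge_add_one_self[of "- c * r n"] by (intro mult_right_mono) (auto simp: u_def)
    finally have "v (Suc n) - d \<le> exp (- c * r n) * u n" .
    moreover have "0 \<le> exp (- c * r n) * u n" by (simp add: u_def)
    ultimately show ?thesis by (simp add: u_def)
  qed
  have u_bound: "u n \<le> exp (- c * ((\<Sum>k<n. r k) - (\<Sum>k<m. r k))) * u m" if "n \<ge> m" for n
    using that
  proof (induction n rule: dec_induct)
    case (step n)
    have "u (Suc n) \<le> exp (- c * r n) * u n" using u_step step by auto
    also have "\<dots> \<le> exp (- c * r n) * (exp (- c * ((\<Sum>k<n. r k) - (\<Sum>k<m. r k))) * u m)"
      using step by (intro mult_left_mono) auto
    also have "\<dots> = exp (- c * ((\<Sum>k<Suc n. r k) - (\<Sum>k<m. r k))) * u m"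
      by (simp add: exp_add[symmetric] algebra_simps)
    finally show ?case .
  qed simp
  have "filterlim (\<lambda>n. - c * ((\<Sum>k<n. r k) - (\<Sum>k<m. r k))) at_bot sequentially"
  proof -
    have "filterlim (\<lambda>n. - (\<Sum>k<m. r k) + (\<Sum>k<n. r k)) at_top sequentially"
      by (intro filterlim_tendsto_add_at_top[OF tendsto_const r(3)])
    then have "filterlim (\<lambda>n. c * (- (\<Sum>k<m. r k) + (\<Sum>k<n. r k))) at_top sequentially"
      by (intro filterlim_tendsto_pos_mult_at_top[OF tendsto_const c])
    then show ?thesis unfolding filterlim_uminus_at_top by (simp add: algebra_simps)
  qed
  then have "(\<lambda>n. exp (- c * ((\<Sum>k<n. r k) - (\<Sum>k<m. r k))) * u m) \<longlonglongrightarrow> 0 * u m"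
    by (intro tendsto_intros filterlim_compose[OF exp_at_bot])
  then have "\<forall>\<^sub>F n in sequentially. exp (- c * ((\<Sum>k<n. r k) - (\<Sum>k<m. r k))) * u m < d"
    using d by (intro order_tendstoD) auto
  with eventually_ge_at_top[of m] have "\<forall>\<^sub>F n in sequentially. norm (v n - 0) < \<delta>"
  proof eventually_elim
    case (elim n)
    then have "u n < d" using u_bound[of n] by linarith
    then show ?case using v[of n] by (simp add: u_def d_def max_def split: if_splits)
  qed
  then show "\<exists>no. \<forall>n\<ge>no. norm (v n - 0) < \<delta>" by (simp add: eventually_sequentially)
qed

section \<open>Powers of a power bounded operator and of its average with the identity\<close>

locale power_bounded =
  fixes P :: "'a::euclidean_space \<Rightarrow> 'a" and C :: real
  assumes linear: "linear P"
    and power_bound: "\<And>k x. norm ((P ^^ k) x) \<le> C * norm x"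
begin

definition K :: "'a \<Rightarrow> 'a" where "K x = P x - x"

text \<open>\<open>P\<close> and \<open>Q\<close> have the same fixed vectors, and
  \<open>Q = I + K / 2\<close> is the drift step of size 1/2.\<close>

definition Q :: "'a \<Rightarrow> 'a" where "Q x = (1 / 2) *\<^sub>R (x + P x)"

lemma C_pos: "C > 0"
proof -
  obtain b :: 'a where "b \<in> Basis" using nonempty_Basis by blast
  then show ?thesis using power_bound[of 0 b] by simp
qed

lemma linear_K: "linear K"
  unfolding K_def using linear by (intro linear_compose_sub linear_id[unfolded id_def]) 

lemma linear_Q: "linear Q"
  unfolding Q_def using linear
  by (intro linear_compose_scale_right linear_compose_add linear_id[unfolded id_def]) 

lemma funpow_linear: "linear f \<Longrightarrow> linear (f ^^ k)" for f :: "'a \<Rightarrow> 'a"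
proof (induction k)
  case 0
  then show ?case using linear_id by (simp add: id_def)
next
  case (Suc k)
  then show ?case using linear_compose[of "f ^^ k" f] by (simp add: o_def)
qed

lemma funpow_Q: "(Q ^^ k) x = (1 / 2 ^ k) *\<^sub>R (\<Sum>j\<le>k. real (k choose j) *\<^sub>R (P ^^ j) x)"
proof (induction k)
  case (Suc k)
  have PP: "P (\<Sum>j\<le>k. real (k choose j) *\<^sub>R (P ^^ j) x) = (\<Sum>j\<le>k. real (k choose j) *\<^sub>R (P ^^ Suc j) x)"
    by (simp add: linear_sum[OF linear] linear_scale[OF linear])
  show ?case
    unfolding sum_binomial_Suc
    by (simp add: Suc.IH Q_def[of "(1 / 2 ^ k) *\<^sub>R _"] linear_scale[OF linear] PP scaleR_add_right sum.distrib)
qed simp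

lemma norm_funpow_Q: "norm ((Q ^^ k) x) \<le> C * norm x"
proof -
  have "norm (\<Sum>j\<le>k. real (k choose j) *\<^sub>R (P ^^ j) x) \<le> (\<Sum>j\<le>k. real (k choose j) * (C * norm x))"
    by (intro sum_norm_le) (auto intro!: mult_left_mono power_bound)
  also have "\<dots> = real (\<Sum>j\<le>k. k choose j) * (C * norm x)"
    by (simp add: sum_distrib_right)
  finally show ?thesis
    unfolding funpow_Q choose_row_sum by (simp add: field_simps)
qed

text \<open>\<open>Q^k K v\<close> is \<open>2^-k\<close> times a binomial sum of differences of
  consecutive iterates of \<open>v\<close>. Summation by parts moves the differences onto the
  coefficients, whose absolute sum is at most \<open>2^(k+1) / sqrt (k+1)\<close>; each iterate
  costs a factor \<open>C\<close>.\<close>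

lemma norm_funpow_Q_K: "norm ((Q ^^ k) (K v)) \<le> 2 * C * norm v / sqrt (real (Suc k))"
proof -
  let ?n = "Suc k" and ?g = "\<lambda>j. (P ^^ j) v"
  have "(P ^^ j) (K v) = ?g (Suc j) - ?g j" for j
    unfolding K_def linear_diff[OF funpow_linear[OF linear]]
    by (simp only: funpow_Suc_right comp_def)
  then have "(2 ^ k * real ?n) *\<^sub>R (Q ^^ k) (K v)
      = real ?n *\<^sub>R (\<Sum>j\<le>k. real (k choose j) *\<^sub>R (?g (Suc j) - ?g j))"
    unfolding funpow_Q by (simp del: of_nat_Suc)
  also have "norm \<dots> \<le> (\<Sum>j\<le>?n. real (?n choose j) * \<bar>2 * real j - real ?n\<bar> * (C * norm v))"
    unfolding sum_binomial_diff[where g = ?g]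
    by (rule sum_norm_le) (auto simp: abs_mult intro!: mult_left_mono power_bound)
  also have "\<dots> = (\<Sum>j\<le>?n. real (?n choose j) * \<bar>2 * real j - real ?n\<bar>) * (C * norm v)"
    by (simp only: sum_distrib_right)
  also have "\<dots> \<le> (sqrt (real ?n) * 2 ^ ?n) * (C * norm v)"
    using C_pos by (intro mult_right_mono sum_binomial_abs_deviation) auto
  finally have "(2 ^ k * real ?n) * norm ((Q ^^ k) (K v)) \<le> (sqrt (real ?n) * 2 ^ ?n) * (C * norm v)"
    by (simp add: abs_mult)
  moreover have "(2 ^ k * real ?n) * norm ((Q ^^ k) (K v))
      = (2 ^ k * sqrt (real ?n)) * (sqrt (real ?n) * norm ((Q ^^ k) (K v)))"
    using real_sqrt_mult_self[of "real ?n"] by simp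
  moreover have "(sqrt (real ?n) * 2 ^ ?n) * (C * norm v) = (2 ^ k * sqrt (real ?n)) * (2 * (C * norm v))"
    by simp
  ultimately have "sqrt (real ?n) * norm ((Q ^^ k) (K v)) \<le> 2 * (C * norm v)"
    by (simp only: mult_le_cancel_left_pos zero_less_mult_iff zero_less_power real_sqrt_gt_0_iff
        of_nat_0_less_iff zero_less_Suc zero_less_numeral simp_thms)
  moreover have "sqrt (real ?n) > 0" by simp
  ultimately show ?thesis by (simp only: pos_le_divide_eq mult.commute mult.left_commute)
qed

lemma funpow_Q_K_bound_tendsto_0: "(\<lambda>k. 2 * C * b / sqrt (real (Suc k))) \<longlonglongrightarrow> 0"
  by real_asymp

text \<open>There is no Jordan block at the eigenvalue 1: \<open>K v\<close> would be fixed by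
  \<open>Q\<close>, whereas the \<open>Q\<close>-orbit of any vector of \<open>range K\<close> tends
  to 0.\<close>

lemma ker_range_K:
  assumes "K (K v) = 0"
  shows "K v = 0"
proof -
  have "Q (K v) = K v" using assms by (simp add: Q_def K_def)
  then have "(Q ^^ k) (K v) = K v" for k by (induction k) auto
  then have "norm (K v) \<le> 2 * C * norm v / sqrt (real (Suc k))" for k
    using norm_funpow_Q_K[of k v] by simp
  then have "norm (K v) \<le> 0"
    by (intro LIMSEQ_le_const[OF funpow_Q_K_bound_tendsto_0]) auto
  then show ?thesis by simp
qed

text \<open>\<open>K\<close> is injective on its own range, hence by dimension maps it onto itself.
  So \<open>K \<circ> g\<close> is a linear choice of preimages under \<open>K\<close> for the
  vectors of \<open>range K\<close>, and \<open>K \<circ> g \<circ> K\<close> is the projection onto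
  \<open>range K\<close> along the kernel.\<close>

lemma right_inverse_K_K:
  "\<exists>g. linear g \<and> (\<forall>x. K (K (g (K x))) = K x)"
proof -
  have sub: "subspace (range K)" 
    using linear_subspace_image[OF linear_K subspace_UNIV] .
  have "inj_on K (range K)"
  proof (rule inj_onI, elim imageE)
    fix x y u w assume "K x = K y" "x = K u" "y = K w"
    then have "K (K (u - w)) = 0" by (simp add: linear_diff[OF linear_K])
    from ker_range_K[OF this] show "x = y"
      using \<open>x = K u\<close> \<open>y = K w\<close> by (simp add: linear_diff[OF linear_K])
  qed
  then have "dim (K ` range K) = dim (range K)"
    using sub by (intro dim_image_eq[OF linear_K]) (simp add: span_eq_iff[THEN iffD2])
  then have "K ` range K = range K"
    using subspace_dim_equal[OF linear_subspace_image[OF linear_K sub] sub] by auto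
  then have eq: "range (K \<circ> K) = range K" by (simp add: image_comp)
  obtain g where g: "linear g" "\<forall>v\<in>range (K \<circ> K). (K \<circ> K) (g v) = v"
    using linear_exists_right_inverse_on[OF linear_compose[OF linear_K linear_K] subspace_UNIV] by blast
  moreover have "K (K (g (K x))) = K x" for x
    using g(2)[unfolded eq, rule_format, OF rangeI] by simp
  ultimately show ?thesis by blast
qed

text \<open>For large \<open>N\<close>, a norm in which the drift contracts on
  \<open>range K\<close>: passing from \<open>x\<close> to \<open>Q x\<close> shifts the orbit, so
  the sum loses \<open>norm x\<close> and gains only the term of index \<open>N\<close>.\<close>

definition V :: "nat \<Rightarrow> 'a \<Rightarrow> real" where "V N x = (\<Sum>k<N. norm ((Q ^^ k) x))"

lemma V_nonneg: "0 \<le> V N x"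
  by (simp add: V_def sum_nonneg)

lemma V_add: "V N (x + y) \<le> V N x + V N y"
  unfolding V_def sum.distrib[symmetric]
  by (intro sum_mono) (simp add: linear_add[OF funpow_linear[OF linear_Q]] norm_triangle_ineq)

lemma V_scaleR: "V N (c *\<^sub>R x) = \<bar>c\<bar> * V N x"
  unfolding V_def by (simp add: linear_scale[OF funpow_linear[OF linear_Q]] sum_distrib_left)

lemma V_le: "V N x \<le> real N * C * norm x"
  using sum_mono[of "{..<N}" "\<lambda>k. norm ((Q ^^ k) x)" "\<lambda>_. C * norm x", OF norm_funpow_Q]
  by (simp add: V_def)

lemma V_Q: "V N (Q x) = V N x - norm x + norm ((Q ^^ N) x)"
proof -
  have "V N (Q x) = (\<Sum>k<N. norm ((Q ^^ Suc k) x))"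
    unfolding V_def by (simp only: funpow_Suc_right comp_def)
  also have "\<dots> = V N x - norm x + norm ((Q ^^ N) x)"
    unfolding V_def by (induction N) (auto simp: sum.lessThan_Suc)
  finally show ?thesis .
qed

lemma norm_le_V: "N > 0 \<Longrightarrow> norm x \<le> V N x"
  unfolding V_def using member_le_sum[of 0 "{..<N}" "\<lambda>k. norm ((Q ^^ k) x)"] by simp

lemma V_decrease:
  "\<exists>N>0. \<exists>c>0. \<forall>x\<in>range K. \<forall>s\<in>{0..1 / 2}. V N (x + s *\<^sub>R K x) \<le> (1 - c * s) * V N x"
proof -
  obtain g where g: "linear g" "\<And>x. K (K (g (K x))) = K x"
    using right_inverse_K_K by blast
  obtain B where B: "B > 0" "\<And>x. norm ((K \<circ> g) x) \<le> B * norm x"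
    using linear_bounded_pos[OF linear_compose[OF g(1) linear_K]] by auto
  have "\<forall>\<^sub>F k in sequentially. 2 * C * B / sqrt (real (Suc k)) < 1 / 2"
    by (rule order_tendstoD[OF funpow_Q_K_bound_tendsto_0]) simp
  then obtain N where N: "2 * C * B / sqrt (real (Suc N)) < 1 / 2" "N > 0"
    using eventually_conj[OF _ eventually_gt_at_top[of 0]] by (metis (no_types, lifting) eventually_sequentially order_refl)
  have half: "norm ((Q ^^ N) x) \<le> norm x / 2" if "x \<in> range K" for x
  proof -
    \<comment> \<open>The preimage has norm at most \<open>B * norm x\<close>, so the decay along
      single vectors becomes uniform over \<open>range K\<close>; \<open>N\<close> was chosen to
      make the factor 1/2.\<close>
    have x: "x = K ((K \<circ> g) x)" using that g(2) by auto
    have "norm ((Q ^^ N) x) \<le> 2 * C * norm ((K \<circ> g) x) / sqrt (real (Suc N))"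
      by (subst x) (rule norm_funpow_Q_K)
    also have "\<dots> \<le> 2 * C * (B * norm x) / sqrt (real (Suc N))"
      using B(2)[of x] C_pos by (intro divide_right_mono mult_left_mono) auto
    also have "\<dots> = (2 * C * B / sqrt (real (Suc N))) * norm x" by simp
    also have "\<dots> \<le> 1 / 2 * norm x" using N by (intro mult_right_mono) auto
    finally show ?thesis by simp
  qed
  show ?thesis
  \<comment> \<open>One step of \<open>Q\<close> costs at least \<open>norm x / 2\<close>, a step of
    size \<open>s\<close> is the fraction \<open>2 * s\<close> of it, and \<open>norm x\<close> is
    at least \<open>V N x / (N * C)\<close>; this is the origin of the rate.\<close>
  proof (intro exI[of _ N] exI[of _ "1 / (real N * C)"] conjI ballI)
    show "N > 0" by fact
    show "1 / (real N * C) > 0" using N C_pos by simp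
    fix s x assume x: "x \<in> range K" and "s \<in> {0..(1::real) / 2}"
    then have s: "0 \<le> s" "s \<le> 1 / 2" by auto
    \<comment> \<open>As \<open>Q = I + K / 2\<close>, the step is a combination of \<open>x\<close>
      and \<open>Q x\<close>, convex because \<open>s \<le> 1 / 2\<close>.\<close>
    have "x + s *\<^sub>R K x = (1 - 2 * s) *\<^sub>R x + (2 * s) *\<^sub>R Q x"
    proof -
      have "(2 * s) *\<^sub>R Q x = s *\<^sub>R x + s *\<^sub>R P x" by (simp add: Q_def scaleR_add_right)
      moreover have "(1 - 2 * s) *\<^sub>R x = x - (s *\<^sub>R x + s *\<^sub>R x)"
        by (simp add: scaleR_left_diff_distrib scaleR_add_left[symmetric])
      ultimately show ?thesis by (simp add: K_def scaleR_diff_right)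
    qed
    also have "V N \<dots> \<le> (1 - 2 * s) * V N x + 2 * s * V N (Q x)"
      using V_add[of N "(1 - 2 * s) *\<^sub>R x" "(2 * s) *\<^sub>R Q x"] s by (simp add: V_scaleR)
    also have "\<dots> \<le> (1 - 2 * s) * V N x + 2 * s * (V N x - norm x / 2)"
      using half[OF x] s by (intro add_left_mono mult_left_mono) (auto simp: V_Q)
    also have "\<dots> = V N x - s * norm x" by (simp add: algebra_simps)
    also have "\<dots> \<le> V N x - s * (V N x / (real N * C))"
      using V_le[of N x] N C_pos s by (intro diff_left_mono mult_left_mono) (auto simp: field_simps)
    also have "\<dots> = (1 - 1 / (real N * C) * s) * V N x" by (simp add: algebra_simps)
    finally show "V N (x + s *\<^sub>R K x) \<le> (1 - 1 / (real N * C) * s) * V N x" .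
  qed
qed

text \<open>The noise is removed by adding its remaining sum \<open>\<rho> n\<close> to the state.
  The shifted state follows the drift up to the error \<open>r n *\<^sub>R K (\<rho> n)\<close>,
  which lies in \<open>range K\<close> and is small compared with \<open>r n\<close>. Its kernel
  component is therefore conserved exactly, while its component in \<open>range K\<close> contracts
  to 0.\<close>

theorem stochastic_approximation_converges:
  fixes x e :: "nat \<Rightarrow> 'a" and r :: "nat \<Rightarrow> real"
  assumes r: "\<And>n. 0 \<le> r n" "r \<longlonglongrightarrow> 0" "filterlim (\<lambda>n. \<Sum>k<n. r k) at_top sequentially"
    and noise: "summable (\<lambda>n. r n *\<^sub>R e n)"
    and step: "\<And>n. x (Suc n) = x n + r n *\<^sub>R (P (x n) - x n + e n)"
  shows "\<exists>l. P l = l \<and> x \<longlonglongrightarrow> l"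
proof -
  obtain g where g: "linear g" "\<And>x. K (K (g (K x))) = K x"
    using right_inverse_K_K by blast
  define \<beta> where "\<beta> x = K (g (K x))" for x
  have lin_\<beta>: "linear \<beta>"
    using linear_compose[OF linear_compose[OF linear_K g(1)] linear_K] by (simp add: \<beta>_def[abs_def] o_def)
  have K_\<beta>: "K (\<beta> y) = K y" for y by (simp add: \<beta>_def g(2))
  have \<beta>_K: "\<beta> (K y) = K y" for y
  proof -
    have "\<beta> (K y) - K y = K (g (K (K y)) - y)" by (simp add: \<beta>_def linear_diff[OF linear_K])
    moreover have "K (\<beta> (K y) - K y) = 0" by (simp add: K_\<beta> linear_diff[OF linear_K])
    ultimately show ?thesis using ker_range_K by (metis eq_iff_diff_eq_0)
  qed
  define \<rho> where "\<rho> n = (\<Sum>k. r (k + n) *\<^sub>R e (k + n))" for n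
  have \<rho>_Suc: "\<rho> (Suc n) = \<rho> n - r n *\<^sub>R e n" for n
    unfolding \<rho>_def using suminf_split_head[OF summable_ignore_initial_segment[OF noise, of n]] by simp
  have \<rho>_0: "\<rho> \<longlonglongrightarrow> 0"
  proof -
    have "\<rho> = (\<lambda>n. (\<Sum>k. r k *\<^sub>R e k) - (\<Sum>k<n. r k *\<^sub>R e k))"
      by (auto simp: \<rho>_def suminf_minus_initial_segment[OF noise])
    moreover have "(\<lambda>n. (\<Sum>k. r k *\<^sub>R e k) - (\<Sum>k<n. r k *\<^sub>R e k)) \<longlonglongrightarrow> (\<Sum>k. r k *\<^sub>R e k) - (\<Sum>k. r k *\<^sub>R e k)"
      by (intro tendsto_intros summable_LIMSEQ noise)
    ultimately show ?thesis by simp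
  qed
  define y where "y n = x n + \<rho> n" for n
  have y_Suc: "y (Suc n) = y n + r n *\<^sub>R K (y n) - r n *\<^sub>R K (\<rho> n)" for n
    unfolding y_def by (simp add: step \<rho>_Suc K_def algebra_simps linear_add[OF linear])
  \<comment> \<open>The kernel component of \<open>x 0 + \<rho> 0\<close>, which will be the limit:
    the whole noise enters it through \<open>\<rho> 0\<close>.\<close>
  define a where "a = y 0 - \<beta> (y 0)"
  have Ka: "K a = 0" by (simp add: a_def linear_diff[OF linear_K] K_\<beta>)
  have y_\<beta>: "y n - \<beta> (y n) = a" for n
  proof (induction n)
    case (Suc n)
    have "\<beta> (y (Suc n)) = \<beta> (y n) + r n *\<^sub>R K (y n) - r n *\<^sub>R K (\<rho> n)"
      unfolding y_Suc by (simp add: linear_add[OF lin_\<beta>] linear_diff[OF lin_\<beta>] linear_scale[OF lin_\<beta>] \<beta>_K)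
    then have "y (Suc n) - \<beta> (y (Suc n)) = y n - \<beta> (y n)"
      unfolding y_Suc by simp
    then show ?case using Suc by simp
  qed (simp add: a_def)
  define b where "b n = \<beta> (y n)" for n
  have b_Suc: "b (Suc n) = (b n + r n *\<^sub>R K (b n)) + r n *\<^sub>R (- K (\<rho> n))" for n
    unfolding b_def y_Suc
    by (simp add: linear_add[OF lin_\<beta>] linear_diff[OF lin_\<beta>] linear_scale[OF lin_\<beta>] \<beta>_K K_\<beta>)
  obtain N c where Nc: "N > 0" "c > 0"
    "\<forall>x\<in>range K. \<forall>s\<in>{0..1 / 2}. V N (x + s *\<^sub>R K x) \<le> (1 - c * s) * V N x"
    using V_decrease by metis
  have "(\<lambda>n. V N (b n)) \<longlonglongrightarrow> 0"
  proof (rule perturbed_contraction_tendsto_0[where \<epsilon> = "\<lambda>n. V N (- K (\<rho> n))", OF Nc(2) _ r])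
    show "0 \<le> V N (b n)" for n by (rule V_nonneg)
    have "(\<lambda>n. norm (K (\<rho> n))) \<longlonglongrightarrow> norm (K 0)"
      using linear_K by (intro tendsto_norm bounded_linear.tendsto[OF _ \<rho>_0])
        (simp add: linear_conv_bounded_linear)
    then have "(\<lambda>n. real N * C * norm (K (\<rho> n))) \<longlonglongrightarrow> real N * C * 0"
      unfolding linear_0[OF linear_K] norm_zero by (rule tendsto_mult[OF tendsto_const])
    moreover have "V N (- K (\<rho> n)) \<le> real N * C * norm (K (\<rho> n))" for n
      using V_le[of N "- K (\<rho> n)"] by simp
    ultimately show "(\<lambda>n. V N (- K (\<rho> n))) \<longlonglongrightarrow> 0"
      using Lim_null_comparison[of "\<lambda>n. V N (- K (\<rho> n))" "\<lambda>n. real N * C * norm (K (\<rho> n))" sequentially]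
      by (simp add: V_nonneg)
    have "\<forall>\<^sub>F n in sequentially. r n < 1 / 2" using r(2) by (intro order_tendstoD) auto
    then show "\<forall>\<^sub>F n in sequentially. V N (b (Suc n)) \<le> (1 - c * r n) * V N (b n) + r n * V N (- K (\<rho> n))"
    proof eventually_elim
      case (elim n)
      have "V N (b (Suc n)) \<le> V N (b n + r n *\<^sub>R K (b n)) + r n * V N (- K (\<rho> n))"
        unfolding b_Suc using V_add[of N "b n + r n *\<^sub>R K (b n)" "r n *\<^sub>R (- K (\<rho> n))"] r(1)[of n]
        by (simp only: V_scaleR abs_of_nonneg)
      also have "V N (b n + r n *\<^sub>R K (b n)) \<le> (1 - c * r n) * V N (b n)"
        using elim r(1) by (intro Nc(3)[rule_format]) (auto simp: b_def \<beta>_def)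
      finally show ?case by simp
    qed
  qed
  then have "b \<longlonglongrightarrow> 0"
    using Lim_null_comparison[of b "\<lambda>n. V N (b n)" sequentially] norm_le_V[OF Nc(1)] by simp
  then have "(\<lambda>n. a + b n - \<rho> n) \<longlonglongrightarrow> a + 0 - 0"
    by (intro tendsto_intros \<rho>_0)
  moreover have "a + b n - \<rho> n = x n" for n
    using y_\<beta>[of n] unfolding b_def y_def by (simp add: algebra_simps)
  ultimately have "x \<longlonglongrightarrow> a" by simp
  moreover have "P a = a" using Ka by (simp add: K_def)
  ultimately show ?thesis by blast
qed

end

section \<open>Convergence of square-summable martingale differences\<close>

text \<open>Orthogonality to bounded \<open>F n\<close>-measurable functions stands in for a
  vanishing conditional expectation: the martingale property is applied only in this form, and it is
  checked by integrals alone.\<close>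

locale bounded_martingale_differences = prob_space M
  for M :: "'a measure" and F :: "nat \<Rightarrow> 'a measure" and D :: "nat \<Rightarrow> 'a \<Rightarrow> real" and c :: "nat \<Rightarrow> real" +
  assumes subalgebra: "\<And>n. subalgebra M (F n)"
    and sets_Suc: "\<And>n. sets (F n) \<subseteq> sets (F (Suc n))"
    and adapted: "\<And>n. D n \<in> borel_measurable (F (Suc n))"
    and D_bound: "\<And>n. AE \<omega> in M. \<bar>D n \<omega>\<bar> \<le> c n"
    and orthogonal: "\<And>n g b. g \<in> borel_measurable (F n) \<Longrightarrow> AE \<omega> in M. \<bar>g \<omega>\<bar> \<le> b \<Longrightarrow>
      (\<integral>\<omega>. g \<omega> * D n \<omega> \<partial>M) = 0"
begin

lemma space_F: "space (F n) = space M"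
  using subalgebra[of n] by (simp add: subalgebra_def)

lemma measurable_F_mono:
  assumes "f \<in> borel_measurable (F m)" "m \<le> n"
  shows "f \<in> borel_measurable (F n)"
proof -
  have "sets (F m) \<subseteq> sets (F n)"
    using assms(2) by (rule lift_Suc_mono_le[where f="\<lambda>n. sets (F n)", OF sets_Suc])
  then have "subalgebra (F n) (F m)" by (simp add: subalgebra_def space_F)
  then show ?thesis using assms(1) measurable_from_subalg by blast
qed

lemma D_measurable [measurable]: "D n \<in> borel_measurable M"
  using measurable_from_subalg[OF subalgebra adapted] .

lemma partial_sum_measurable:
  assumes "\<And>k. h k \<in> borel_measurable (F k)"
  shows "(\<lambda>\<omega>. \<Sum>k<n. h k \<omega> * D k \<omega>) \<in> borel_measurable (F n)"
proof (rule borel_measurable_sum)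
  fix k assume k: "k \<in> {..<n}"
  then have "h k \<in> borel_measurable (F n)" "D k \<in> borel_measurable (F n)"
    using measurable_F_mono[OF assms(1), of k n] measurable_F_mono[OF adapted, of k n] by auto
  then show "(\<lambda>\<omega>. h k \<omega> * D k \<omega>) \<in> borel_measurable (F n)" by simp
qed

lemma partial_sum_bound:
  assumes "\<And>k \<omega>. \<bar>h k \<omega>\<bar> \<le> (1::real)"
  shows "AE \<omega> in M. \<bar>\<Sum>k<n. h k \<omega> * D k \<omega>\<bar> \<le> (\<Sum>k<n. c k)"
proof -
  have "AE \<omega> in M. \<forall>k. \<bar>D k \<omega>\<bar> \<le> c k"
    by (simp add: AE_all_countable D_bound)
  then show ?thesis
  proof eventually_elim
    case (elim \<omega>)
    have "\<bar>h k \<omega> * D k \<omega>\<bar> \<le> c k" for k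
      using mult_mono[OF assms[of k \<omega>] elim[rule_format, of k]] by (simp add: abs_mult)
    then show ?case by (intro order_trans[OF sum_abs] sum_mono) auto
  qed
qed

text \<open>The multipliers \<open>h\<close> are predictable, so \<open>T * h n\<close> is bounded
  and \<open>F n\<close>-measurable and the cross term vanishes. Stopping a sum amounts to choosing
  such multipliers.\<close>

lemma second_moment_partial_sum:
  assumes h: "\<And>k. h k \<in> borel_measurable (F k)" "\<And>k \<omega>. \<bar>h k \<omega>\<bar> \<le> 1"
  shows "(\<integral>\<omega>. (\<Sum>k<n. h k \<omega> * D k \<omega>)\<^sup>2 \<partial>M) \<le> (\<Sum>k<n. (c k)\<^sup>2)"
proof (induction n)
  case (Suc n)
  define T where "T \<omega> = (\<Sum>k<n. h k \<omega> * D k \<omega>)" for \<omega>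
  have T: "T \<in> borel_measurable (F n)" "AE \<omega> in M. \<bar>T \<omega>\<bar> \<le> (\<Sum>k<n. c k)"
    using partial_sum_measurable[OF h(1)] partial_sum_bound[of h, OF h(2)] by (simp_all add: T_def[abs_def])
  have [measurable]: "T \<in> borel_measurable M" "h n \<in> borel_measurable M"
    using measurable_from_subalg[OF subalgebra T(1)] measurable_from_subalg[OF subalgebra h(1)] .
  have hb: "AE \<omega> in M. \<bar>h n \<omega>\<bar> \<le> 1" using h(2) by simp
  have hD: "AE \<omega> in M. \<bar>h n \<omega> * D n \<omega>\<bar> \<le> c n"
    using D_bound[of n]
  proof eventually_elim
    case (elim \<omega>)
    then show ?case using mult_mono[OF h(2)[of n \<omega>] elim] by (simp add: abs_mult)
  qed
  \<comment> \<open>No sign of \<open>c\<close> is assumed; a bound on an absolute value that holds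
    almost everywhere in a probability space is nonnegative.\<close>
  have cs: "(\<Sum>k<n. c k) \<ge> 0"
  proof -
    have "AE \<omega> in M. 0 \<le> (\<Sum>k<n. c k)" using T(2) by eventually_elim auto
    then show ?thesis by simp
  qed
  have int1: "integrable M (\<lambda>\<omega>. (T \<omega>)\<^sup>2)"
    using T(2) by (intro integrable_const_bound[where B="(\<Sum>k<n. c k)\<^sup>2"])
      (auto elim!: eventually_mono simp: abs_le_square_iff[symmetric])
  have Th: "AE \<omega> in M. \<bar>T \<omega> * h n \<omega>\<bar> \<le> (\<Sum>k<n. c k) * 1"
    using T(2)
  proof eventually_elim
    case (elim \<omega>)
    then show ?case using mult_mono[OF elim h(2)[of n \<omega>]] cs by (simp add: abs_mult)
  qed
  have int2: "integrable M (\<lambda>\<omega>. (T \<omega> * h n \<omega>) * D n \<omega>)"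
  proof (rule integrable_const_bound[where B="(\<Sum>k<n. c k) * c n"])
    show "AE \<omega> in M. norm ((T \<omega> * h n \<omega>) * D n \<omega>) \<le> (\<Sum>k<n. c k) * c n"
      using Th D_bound[of n]
    proof eventually_elim
      case (elim \<omega>)
      then show ?case using mult_mono[OF elim] cs by (simp add: abs_mult)
    qed
  qed simp
  have int3: "integrable M (\<lambda>\<omega>. (h n \<omega> * D n \<omega>)\<^sup>2)"
    using hD by (intro integrable_const_bound[where B="(c n)\<^sup>2"])
      (auto elim!: eventually_mono simp: abs_le_square_iff[symmetric])
  have "(\<integral>\<omega>. (\<Sum>k<Suc n. h k \<omega> * D k \<omega>)\<^sup>2 \<partial>M)
      = (\<integral>\<omega>. (T \<omega>)\<^sup>2 + 2 * ((T \<omega> * h n \<omega>) * D n \<omega>) + (h n \<omega> * D n \<omega>)\<^sup>2 \<partial>M)"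
    by (intro Bochner_Integration.integral_cong) (auto simp: T_def power2_eq_square algebra_simps)
  also have "\<dots> = (\<integral>\<omega>. (T \<omega>)\<^sup>2 \<partial>M) + 2 * (\<integral>\<omega>. (T \<omega> * h n \<omega>) * D n \<omega> \<partial>M)
      + (\<integral>\<omega>. (h n \<omega> * D n \<omega>)\<^sup>2 \<partial>M)"
    using int1 int2 int3 by simp
  also have "(\<integral>\<omega>. (T \<omega> * h n \<omega>) * D n \<omega> \<partial>M) = 0"
    using T(1) h(1)[of n] by (intro orthogonal[OF _ Th]) simp
  also have "(\<integral>\<omega>. (h n \<omega> * D n \<omega>)\<^sup>2 \<partial>M) \<le> (c n)\<^sup>2"
    using hD by (intro integral_le_const[OF int3]) (auto elim!: eventually_mono simp: abs_le_square_iff[symmetric])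
  finally show ?case using Suc by (simp add: T_def)
qed simp

text \<open>The sum stopped when it first leaves \<open>(-\<epsilon>, \<epsilon>)\<close> is again of the form treated in
  \<open>second_moment_partial_sum\<close>, and it exceeds \<open>\<epsilon>\<close> on the event in question.\<close>
lemma maximal_inequality:
  assumes "\<epsilon> > 0"
  shows "prob {\<omega> \<in> space M. \<exists>j\<le>n. \<epsilon> \<le> \<bar>\<Sum>k<j. D k \<omega>\<bar>} \<le> (\<Sum>k<n. (c k)\<^sup>2) / \<epsilon>\<^sup>2"
proof -
  define S where "S j \<omega> = (\<Sum>k<j. D k \<omega>)" for j \<omega>
  \<comment> \<open>\<open>h k\<close> looks at \<open>S\<close> up to and including the index
    \<open>k\<close>: \<open>S k\<close> involves only \<open>D\<close> below \<open>k\<close> and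
    so is \<open>F k\<close>-measurable, one index before \<open>D k\<close>. Thus \<open>T\<close>
    keeps the increment that causes the first exit and none after it.\<close>
  define h :: "nat \<Rightarrow> 'a \<Rightarrow> real" where "h k \<omega> = (if \<forall>j\<le>k. \<bar>S j \<omega>\<bar> < \<epsilon> then 1 else 0)" for k \<omega>
  define T where "T \<omega> = (\<Sum>k<n. h k \<omega> * D k \<omega>)" for \<omega>
  have S_F: "S j \<in> borel_measurable (F k)" if "j \<le> k" for j k
    using measurable_F_mono[OF partial_sum_measurable[of "\<lambda>_ _. 1" j] that] by (simp add: S_def[abs_def])
  have h: "h k \<in> borel_measurable (F k)" "\<bar>h k \<omega>\<bar> \<le> 1" for k \<omega>
  proof -
    have "h k = (\<lambda>\<omega>. \<Prod>j\<le>k. if \<bar>S j \<omega>\<bar> < \<epsilon> then 1 else 0)"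
      by (auto simp: h_def fun_eq_iff)
    also have "\<dots> \<in> borel_measurable (F k)"
    proof (rule borel_measurable_prod)
      fix j assume "j \<in> {..k}"
      then have [measurable]: "S j \<in> borel_measurable (F k)" using S_F by simp
      show "(\<lambda>\<omega>. if \<bar>S j \<omega>\<bar> < \<epsilon> then 1 else 0 :: real) \<in> borel_measurable (F k)" by measurable
    qed
    finally show "h k \<in> borel_measurable (F k)" .
  qed (simp add: h_def)
  have T_meas [measurable]: "T \<in> borel_measurable M"
    using measurable_from_subalg[OF subalgebra partial_sum_measurable[of h n, OF h(1)]] by (simp add: T_def[abs_def])
  have T_ge: "\<epsilon> \<le> \<bar>T \<omega>\<bar>" if ex: "\<exists>j\<le>n. \<epsilon> \<le> \<bar>S j \<omega>\<bar>" for \<omega>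
  proof -
    define j where "j = (LEAST j. \<epsilon> \<le> \<bar>S j \<omega>\<bar>)"
    have j: "\<epsilon> \<le> \<bar>S j \<omega>\<bar>" "j \<le> n" "\<And>i. i < j \<Longrightarrow> \<bar>S i \<omega>\<bar> < \<epsilon>"
    proof -
      obtain i where i: "i \<le> n" "\<epsilon> \<le> \<bar>S i \<omega>\<bar>" using ex by blast
      show "\<epsilon> \<le> \<bar>S j \<omega>\<bar>" unfolding j_def using i(2) by (rule LeastI)
      show "j \<le> n" using Least_le[of "\<lambda>j. \<epsilon> \<le> \<bar>S j \<omega>\<bar>" i] i by (simp add: j_def)
      show "\<bar>S i \<omega>\<bar> < \<epsilon>" if "i < j" for i using not_less_Least[of i "\<lambda>j. \<epsilon> \<le> \<bar>S j \<omega>\<bar>"] that by (simp add: j_def)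
    qed
    have "h k \<omega> = (if k < j then 1 else 0)" for k
      using j by (auto simp: h_def not_less)
    then have "T \<omega> = (\<Sum>k<n. if k < j then D k \<omega> else 0)"
      unfolding T_def by (intro sum.cong) auto
    also have "\<dots> = (\<Sum>k\<in>{..<n} \<inter> {k. k < j}. D k \<omega>)" by (simp add: sum.If_cases)
    also have "{..<n} \<inter> {k. k < j} = {..<j}" using j(2) by auto
    finally show ?thesis using j(1) by (simp add: S_def)
  qed
  have T_b: "AE \<omega> in M. \<bar>T \<omega>\<bar> \<le> (\<Sum>k<n. c k)" using partial_sum_bound[of h, OF h(2)] by (simp add: T_def)
  have int: "integrable M (\<lambda>\<omega>. (T \<omega>)\<^sup>2)"
    using T_b by (intro integrable_const_bound[where B="(\<Sum>k<n. c k)\<^sup>2"])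
      (auto elim!: eventually_mono simp: abs_le_square_iff[symmetric])
  have [measurable]: "S j \<in> borel_measurable M" for j
    unfolding S_def by measurable
  have "prob {\<omega> \<in> space M. \<exists>j\<le>n. \<epsilon> \<le> \<bar>S j \<omega>\<bar>} \<le> prob {\<omega> \<in> space M. \<epsilon>\<^sup>2 \<le> (T \<omega>)\<^sup>2}"
    using T_ge assms by (intro finite_measure_mono) (auto simp: abs_le_square_iff[symmetric])
  also have "\<dots> \<le> (\<integral>\<omega>. (T \<omega>)\<^sup>2 \<partial>M) / \<epsilon>\<^sup>2"
    using assms by (intro integral_Markov_inequality_measure[OF int]) auto
  also have "\<dots> \<le> (\<Sum>k<n. (c k)\<^sup>2) / \<epsilon>\<^sup>2"
    using second_moment_partial_sum[of h n, OF h] by (intro divide_right_mono) (auto simp: T_def)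
  finally show ?thesis by (simp add: S_def)
qed

lemma maximal_inequality_infinite:
  assumes "\<epsilon> > 0" "summable (\<lambda>k. (c k)\<^sup>2)"
  shows "prob {\<omega> \<in> space M. \<exists>j. \<epsilon> \<le> \<bar>\<Sum>k<j. D k \<omega>\<bar>} \<le> (\<Sum>k. (c k)\<^sup>2) / \<epsilon>\<^sup>2"
proof -
  define A where "A n = {\<omega> \<in> space M. \<exists>j\<le>n. \<epsilon> \<le> \<bar>\<Sum>k<j. D k \<omega>\<bar>}" for n
  have "range A \<subseteq> events" by (auto simp: A_def)
  moreover have "incseq A" unfolding A_def by (intro incseq_SucI) (auto intro: le_SucI)
  ultimately have "(\<lambda>n. prob (A n)) \<longlonglongrightarrow> prob (\<Union>n. A n)" by (rule finite_Lim_measure_incseq)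
  moreover have "prob (A n) \<le> (\<Sum>k. (c k)\<^sup>2) / \<epsilon>\<^sup>2" for n
    unfolding A_def using maximal_inequality[OF assms(1), of n] sum_le_suminf[OF assms(2), of "{..<n}"]
    by (elim order_trans) (auto intro: divide_right_mono)
  ultimately have "prob (\<Union>n. A n) \<le> (\<Sum>k. (c k)\<^sup>2) / \<epsilon>\<^sup>2"
    by (intro LIMSEQ_le_const2[where X="\<lambda>n. prob (A n)"]) auto
  also have "(\<Union>n. A n) = {\<omega> \<in> space M. \<exists>j. \<epsilon> \<le> \<bar>\<Sum>k<j. D k \<omega>\<bar>}"
    by (auto simp: A_def)
  finally show ?thesis .
qed

lemma shift: "bounded_martingale_differences M (\<lambda>n. F (m + n)) (\<lambda>n. D (m + n)) (\<lambda>n. c (m + n))"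
  using subalgebra sets_Suc adapted D_bound orthogonal
  by unfold_locales auto

text \<open>The chance that some sum started at \<open>m\<close> reaches \<open>\<epsilon>\<close>
  is at most a tail of the sum of the \<open>(c k)^2\<close>, divided by
  \<open>\<epsilon>^2\<close>. So almost surely some \<open>m\<close> has only small sums after it,
  and over countably many \<open>\<epsilon>\<close> this is the Cauchy criterion.\<close>

theorem AE_summable:
  assumes "summable (\<lambda>k. (c k)\<^sup>2)"
  shows "AE \<omega> in M. summable (\<lambda>k. D k \<omega>)"
proof -
  have small: "AE \<omega> in M. \<exists>m. \<forall>j. \<bar>\<Sum>k<j. D (m + k) \<omega>\<bar> < \<epsilon>" if "\<epsilon> > 0" for \<epsilon>
  proof -
    define B where "B m = {\<omega> \<in> space M. \<exists>j. \<epsilon> \<le> \<bar>\<Sum>k<j. D (m + k) \<omega>\<bar>}" for m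
    have [measurable]: "B m \<in> events" for m unfolding B_def by measurable
    have le: "prob (B m) \<le> (\<Sum>k. (c (k + m))\<^sup>2) / \<epsilon>\<^sup>2" for m
      using bounded_martingale_differences.maximal_inequality_infinite[OF shift[of m] that]
        summable_ignore_initial_segment[OF assms, of m]
      unfolding B_def by (simp add: add.commute)
    have "(\<lambda>m. (\<Sum>k. (c (k + m))\<^sup>2)) \<longlonglongrightarrow> 0"
    proof -
      have "(\<lambda>m. (\<Sum>k. (c k)\<^sup>2) - (\<Sum>k<m. (c k)\<^sup>2)) \<longlonglongrightarrow> (\<Sum>k. (c k)\<^sup>2) - (\<Sum>k. (c k)\<^sup>2)"
        by (intro tendsto_intros summable_LIMSEQ assms)
      then show ?thesis by (simp add: suminf_minus_initial_segment[OF assms])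
    qed
    then have "(\<lambda>m. (\<Sum>k. (c (k + m))\<^sup>2) / \<epsilon>\<^sup>2) \<longlonglongrightarrow> 0 / \<epsilon>\<^sup>2"
      using that by (intro tendsto_divide tendsto_const) auto
    moreover have "prob (\<Inter>m. B m) \<le> (\<Sum>k. (c (k + m))\<^sup>2) / \<epsilon>\<^sup>2" for m
      by (rule order_trans[OF finite_measure_mono le[of m]]) auto
    ultimately have "prob (\<Inter>m. B m) \<le> 0 / \<epsilon>\<^sup>2"
      by (intro LIMSEQ_le_const[where a="prob (\<Inter>m. B m)"]) auto
    then have "prob (\<Inter>m. B m) = 0" by (simp add: measure_le_0_iff)
    then have "AE \<omega> in M. \<omega> \<notin> (\<Inter>m. B m)"
      by (subst (asm) prob_eq_0) auto
    with AE_space show ?thesis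
      by eventually_elim (auto simp: B_def not_le)
  qed
  \<comment> \<open>Half of \<open>1 / Suc i\<close>, because a block from \<open>m\<close> to
    \<open>n\<close> is the difference of two sums started at \<open>N\<close>.\<close>
  have "AE \<omega> in M. \<forall>i::nat. \<exists>m. \<forall>j. \<bar>\<Sum>k<j. D (m + k) \<omega>\<bar> < 1 / (2 * real (Suc i))"
    unfolding AE_all_countable by (intro allI small) simp
  then show ?thesis
  proof eventually_elim
    case (elim \<omega>)
    show ?case unfolding summable_Cauchy
    proof (intro allI impI)
      fix e :: real assume "e > 0"
      then obtain i where i: "inverse (real (Suc i)) < e" using reals_Archimedean by blast
      obtain N where N: "\<And>j. \<bar>\<Sum>k<j. D (N + k) \<omega>\<bar> < 1 / (2 * real (Suc i))" using elim by blast
      have "norm (\<Sum>k=m..<n. D k \<omega>) < e" if "N \<le> m" for m n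
      proof (cases "m \<le> n")
        case True
        have *: "(\<Sum>k=N..<n. D k \<omega>) = (\<Sum>k<n-N. D (N + k) \<omega>)" for n
          using sum.shift_bounds_nat_ivl[of "\<lambda>k. D k \<omega>" 0 N "n - N"]
          by (cases "N \<le> n") (auto simp: atLeast0LessThan add.commute)
        have "(\<Sum>k=m..<n. D k \<omega>) = (\<Sum>k=N..<n. D k \<omega>) - (\<Sum>k=N..<m. D k \<omega>)"
          using sum.atLeastLessThan_concat[OF that True, of "\<lambda>k. D k \<omega>"] by simp
        also have "norm \<dots> < 1 / (2 * real (Suc i)) + 1 / (2 * real (Suc i))"
          using N[of "n - N"] N[of "m - N"] unfolding * by simp
        also have "\<dots> = inverse (real (Suc i))" by (simp add: field_simps)
        finally show ?thesis using i by simp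
      qed (use \<open>e > 0\<close> in simp)
      then show "\<exists>N. \<forall>m\<ge>N. \<forall>n. norm (\<Sum>k=m..<n. D k \<omega>) < e" by blast
    qed
  qed
qed

end

section \<open>Classes and the maximum principle\<close>

text \<open>The sign changes off the diagonal only: a competitive agent opposes the others but still
  follows itself. For \<open>x = z - 1/2\<close> the reversal \<open>1 - z\<close> becomes
  \<open>- x\<close>.\<close>

definition interaction :: "real^'v^'v \<Rightarrow> ('v \<Rightarrow> bool) \<Rightarrow> real^'v^'v" where
  "interaction A competitive = (\<chi> i j. if competitive i \<and> i \<noteq> j then - A $ i $ j else A $ i $ j)"

lemma stochastic_matrix_nonneg: "stochastic_matrix A \<Longrightarrow> 0 \<le> A $ i $ j"
  and stochastic_matrix_row_sum: "stochastic_matrix A \<Longrightarrow> (\<Sum>j\<in>UNIV. A $ i $ j) = 1"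
  by (simp_all add: stochastic_matrix_def)

lemma stochastic_matrix_subset_sum_le:
  fixes A :: "real^'v^'v"
  shows "stochastic_matrix A \<Longrightarrow> (\<Sum>j\<in>S. A $ i $ j) \<le> 1"
  using sum_mono2[of UNIV S "\<lambda>j. A $ i $ j"] by (simp add: stochastic_matrix_def)

lemma abs_interaction: "stochastic_matrix A \<Longrightarrow> \<bar>interaction A competitive $ i $ j\<bar> = A $ i $ j"
  by (simp add: interaction_def stochastic_matrix_def)

text \<open>Centring the states at \<open>1/2\<close> makes the drift linear for both attitudes.\<close>
lemma draw_prob_centred:
  fixes A :: "real^'v^'v"
  assumes "stochastic_matrix A"
  shows "draw_prob A competitive z i - 1 / 2 = (\<Sum>j\<in>UNIV. interaction A competitive $ i $ j * (z $ j - 1 / 2))"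
proof -
  have row: "A $ i $ i + (\<Sum>j\<in>UNIV - {i}. A $ i $ j) = 1"
    using stochastic_matrix_row_sum[OF assms, of i] by (simp add: sum.remove[of UNIV i])
  have *: "(\<Sum>j\<in>UNIV. interaction A competitive $ i $ j * (z $ j - 1 / 2))
    = A $ i $ i * (z $ i - 1 / 2)
      + (\<Sum>j\<in>UNIV - {i}. interaction A competitive $ i $ j * (z $ j - 1 / 2))"
    by (subst sum.remove[of UNIV i]) (simp_all add: interaction_def)
  have "(\<Sum>j\<in>UNIV - {i}. interaction A competitive $ i $ j * (z $ j - 1 / 2))
    = (\<Sum>j\<in>UNIV - {i}. A $ i $ j * (if competitive i then 1 - z $ j else z $ j) - A $ i $ j / 2)"
    by (intro sum.cong) (auto simp: interaction_def field_simps)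
  also have "\<dots> = (\<Sum>j\<in>UNIV - {i}. A $ i $ j * (if competitive i then 1 - z $ j else z $ j))
      - (1 - A $ i $ i) / 2"
    using row by (simp add: sum_subtractf sum_divide_distrib[symmetric])
  finally show ?thesis
    unfolding * draw_prob_def by (simp add: field_simps)
qed

text \<open>Absolute row sums equal to 1 keep the largest entry from growing; the factor
  \<open>CARD('v)\<close> pays for passing from the maximum to the Euclidean norm.\<close>

lemma norm_interaction_power:
  fixes A :: "real^'v^'v"
  assumes "stochastic_matrix A"
  shows "norm (((*v) (interaction A competitive) ^^ k) x) \<le> real CARD('v) * norm x"
proof -
  let ?P = "interaction A competitive"
  have step: "\<bar>(?P *v y) $ i\<bar> \<le> b" if "\<And>j. \<bar>y $ j\<bar> \<le> b" for y b i
  proof -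
    have "\<bar>(?P *v y) $ i\<bar> \<le> (\<Sum>j\<in>UNIV. \<bar>?P $ i $ j * y $ j\<bar>)"
      unfolding matrix_vector_mult_def by simp
    also have "\<dots> \<le> (\<Sum>j\<in>UNIV. A $ i $ j * b)"
      using that assms by (intro sum_mono) (auto simp: abs_mult abs_interaction intro!: mult_left_mono stochastic_matrix_nonneg)
    also have "\<dots> = b" using stochastic_matrix_row_sum[OF assms, of i] by (simp add: sum_distrib_right[symmetric])
    finally show ?thesis .
  qed
  have "\<bar>(((*v) ?P ^^ k) x) $ i\<bar> \<le> norm x" for i
  proof (induction k arbitrary: i)
    case (Suc k)
    then show ?case using step[of "((*v) ?P ^^ k) x"] by simp
  qed (simp add: component_le_norm_cart)
  then have "(\<Sum>i\<in>UNIV. \<bar>(((*v) ?P ^^ k) x) $ i\<bar>) \<le> (\<Sum>i\<in>(UNIV::'v set). norm x)"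
    by (intro sum_mono)
  then show ?thesis
    using norm_le_l1_cart[of "((*v) ?P ^^ k) x"] by simp
qed

section \<open>Classes as strongly connected components of the graph\<close>

lemma edges_lower_level:
  assumes "i \<in> \<Union>(level_classes A m)" "(i, j) \<in> edges A"
  shows "j \<in> (\<Union>k\<in>{..m}. \<Union>(level_classes A k))"
proof -
  obtain T where T: "T \<in> level_classes A m" "i \<in> T" using assms by auto
  have ij: "A $ i $ j \<noteq> 0" using assms(2) by (simp add: edges_def)
  show ?thesis
  proof (cases m)
    case 0
    then have "j \<in> T" using T ij by auto
    then show ?thesis using T by auto
  next
    case (Suc n)
    then have "j \<in> T \<union> (\<Union>k\<in>{..n}. \<Union>(level_classes A k))" using T ij by auto
    then show ?thesis using T Suc by (auto simp: atMost_Suc)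
  qed
qed

lemma reach_lower_levels:
  assumes "(i, j) \<in> (edges A)\<^sup>*" "i \<in> (\<Union>k\<in>{..m}. \<Union>(level_classes A k))"
  shows "j \<in> (\<Union>k\<in>{..m}. \<Union>(level_classes A k))"
  using assms
proof (induction rule: rtrancl_induct)
  case (step y z)
  then obtain k where k: "k \<le> m" "y \<in> \<Union>(level_classes A k)" by auto
  with edges_lower_level[OF k(2) step(2)] show ?case by (auto dest: order_trans)
qed

lemma level_class_communicating: "T \<in> level_classes A m \<Longrightarrow> communicating A T"
  by (cases m) auto

lemma level_class_nonempty: "T \<in> level_classes A m \<Longrightarrow> T \<noteq> {}"
  by (cases m) auto

text \<open>A path that leaves \<open>T\<close> can only enter lower levels, which are closed under
  edges and disjoint from \<open>T\<close>, so it never returns. Hence a class, defined just as some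
  communicating set, is a whole strongly connected component.\<close>

lemma level_class_maximal:
  assumes T: "T \<in> level_classes A m" and i: "i \<in> T"
    and "(i, k) \<in> (edges A)\<^sup>*" "(k, i) \<in> (edges A)\<^sup>*"
  shows "k \<in> T"
proof (cases m)
  case 0
  have closed: "A $ i $ j = 0" if "i \<in> T" "j \<notin> T" for i j using T 0 that by auto
  from assms(3) i show ?thesis
    by (induction rule: rtrancl_induct) (use closed in \<open>auto simp: edges_def\<close>)
next
  case (Suc n)
  define L where "L = (\<Union>k\<in>{..n}. \<Union>(level_classes A k))"
  have T': "T \<inter> L = {}" "\<And>i j. i \<in> T \<Longrightarrow> j \<notin> T \<union> L \<Longrightarrow> A $ i $ j = 0"
    using T by (auto simp: Suc L_def)
  from assms(3) have "k \<in> T \<union> L"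
  proof (induction rule: rtrancl_induct)
    case (step y z)
    show ?case
    proof (cases "y \<in> L")
      case True
      then have "z \<in> L" unfolding L_def using step(2) by (intro reach_lower_levels[of y z]) auto
      then show ?thesis by simp
    next
      case False
      then have "y \<in> T" using step by auto
      then show ?thesis using T'(2)[of y z] step(2) by (auto simp: edges_def)
    qed
  qed (use i in auto)
  moreover have "k \<notin> L"
    using reach_lower_levels[OF assms(4), of n] i T'(1) by (auto simp: L_def)
  ultimately show ?thesis by simp
qed

text \<open>Every agent on a path from \<open>i\<close> to \<open>j\<close> lies on a cycle through
  \<open>i\<close>, hence in \<open>T\<close> by maximality, so propagation along inner edges
  reaches all of \<open>T\<close>. Carrying the premise that \<open>j\<close> can still be reached
  keeps the induction inside the class.\<close>

lemma level_class_induct: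
  assumes T: "T \<in> level_classes A m" and i: "i \<in> T" "Q i"
    and step: "\<And>k l. k \<in> T \<Longrightarrow> l \<in> T \<Longrightarrow> (k, l) \<in> edges A \<Longrightarrow> Q k \<Longrightarrow> Q l"
    and j: "j \<in> T"
  shows "Q j"
proof -
  have com: "(i, j) \<in> (edges A)\<^sup>*" "(j, i) \<in> (edges A)\<^sup>*"
    using level_class_communicating[OF T] i j by (auto simp: communicating_def)
  have "(l, j) \<in> (edges A)\<^sup>* \<longrightarrow> l \<in> T \<and> Q l" if "(i, l) \<in> (edges A)\<^sup>*" for l
    using that
  proof (induction rule: rtrancl_induct)
    case (step y z)
    show ?case
    proof
      assume zj: "(z, j) \<in> (edges A)\<^sup>*"
      then have y: "y \<in> T" "Q y" using step by (auto intro: converse_rtrancl_into_rtrancl)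
      have "z \<in> T"
        using level_class_maximal[OF T i(1), of z] step zj com(2) by (meson rtrancl.rtrancl_into_rtrancl rtrancl_trans)
      then show "z \<in> T \<and> Q z" using y step(2) assms(4) by blast
    qed
  qed (use i in simp)
  then show ?thesis using com by blast
qed

lemma level_class_unique:
  assumes "T \<in> level_classes A m" "T' \<in> level_classes A m" "i \<in> T" "i \<in> T'"
  shows "T = T'"
proof -
  have "S \<subseteq> S'" if "S \<in> level_classes A m" "S' \<in> level_classes A m" "i \<in> S" "i \<in> S'" for S S'
    using level_class_maximal[OF that(2,4)] level_class_communicating[OF that(1)] that(3)
    by (auto simp: communicating_def)
  then show ?thesis using assms by blast
qed

lemma level_class_disjoint:
  assumes "T \<in> level_classes A m" "T' \<in> level_classes A n" "m < n"
  shows "T \<inter> T' = {}"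
  using assms by (cases n) (auto simp: less_Suc_eq_le)

text \<open>Maximum principle: an agent with the largest absolute value \<open>c\<close> is bounded
  by an average of values at most \<open>c\<close> with weights of total at most 1. Equality forces
  \<open>c\<close> on its neighbours in \<open>T\<close> and, unless \<open>c = 0\<close>, weights
  of total exactly 1; connectedness spreads both over \<open>T\<close>.\<close>

lemma level_class_abs_const:
  fixes A :: "real^'v^'v" and x :: "'v \<Rightarrow> real"
  assumes A: "stochastic_matrix A" and T: "T \<in> level_classes A m"
    and sub: "\<And>i. i \<in> T \<Longrightarrow> \<bar>x i\<bar> \<le> (\<Sum>j\<in>T. A $ i $ j * \<bar>x j\<bar>)"
  shows "\<exists>c\<ge>0. (\<forall>i\<in>T. \<bar>x i\<bar> = c) \<and> (c = 0 \<or> (\<forall>i\<in>T. (\<Sum>j\<in>T. A $ i $ j) = 1))"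
proof -
  define c where "c = Max ((\<lambda>i. \<bar>x i\<bar>) ` T)"
  have fin: "finite ((\<lambda>i. \<bar>x i\<bar>) ` T)" "(\<lambda>i. \<bar>x i\<bar>) ` T \<noteq> {}"
    using level_class_nonempty[OF T] by auto
  obtain i0 where i0: "i0 \<in> T" "\<bar>x i0\<bar> = c" using Max_in[OF fin] by (auto simp: c_def)
  have le: "\<bar>x i\<bar> \<le> c" if "i \<in> T" for i using Max_ge[OF fin(1)] that by (simp add: c_def)
  have nn: "0 \<le> A $ i $ j" for i j by (rule stochastic_matrix_nonneg[OF A])
  have sum_le: "(\<Sum>j\<in>T. A $ i $ j * \<bar>x j\<bar>) \<le> (\<Sum>j\<in>T. A $ i $ j) * c" for i
    unfolding sum_distrib_right by (intro sum_mono mult_left_mono le nn)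
  have max: "(\<Sum>j\<in>T. A $ i $ j * \<bar>x j\<bar>) = (\<Sum>j\<in>T. A $ i $ j * c) \<and> (c = 0 \<or> (\<Sum>j\<in>T. A $ i $ j) = 1)"
    if "i \<in> T" "\<bar>x i\<bar> = c" for i
  proof -
    have c0: "0 \<le> c" using that(2) by auto
    have row: "(\<Sum>j\<in>T. A $ i $ j) \<le> 1" by (rule stochastic_matrix_subset_sum_le[OF A])
    have "(\<Sum>j\<in>T. A $ i $ j) * c \<le> c" using mult_right_mono[OF row c0] by simp
    then have eq: "(\<Sum>j\<in>T. A $ i $ j) * c = c" "(\<Sum>j\<in>T. A $ i $ j * \<bar>x j\<bar>) = c"
      using sub[OF that(1)] sum_le[of i] that(2) by linarith+
    have "c = 0 \<or> (\<Sum>j\<in>T. A $ i $ j) = 1" using eq(1) by (metis mult_cancel_right1)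
    then show ?thesis using eq by (simp add: sum_distrib_right)
  qed
  have all: "\<bar>x j\<bar> = c" if "j \<in> T" for j
  proof (rule level_class_induct[where Q="\<lambda>j. \<bar>x j\<bar> = c", OF T i0(1) i0(2) _ that])
    fix k l assume kl: "k \<in> T" "l \<in> T" "(k, l) \<in> edges A" "\<bar>x k\<bar> = c"
    have "A $ k $ l * \<bar>x l\<bar> = A $ k $ l * c"
    proof (rule ccontr)
      assume "A $ k $ l * \<bar>x l\<bar> \<noteq> A $ k $ l * c"
      then have "A $ k $ l * \<bar>x l\<bar> < A $ k $ l * c"
        using mult_left_mono[OF le[OF kl(2)] nn[of k l]] by linarith
      then have "(\<Sum>j\<in>T. A $ k $ j * \<bar>x j\<bar>) < (\<Sum>j\<in>T. A $ k $ j * c)"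
        using kl(2) by (intro sum_strict_mono_ex1) (auto intro!: mult_left_mono le nn)
      with max[OF kl(1,4)] show False by simp
    qed
    then show "\<bar>x l\<bar> = c" using kl(3) by (simp add: edges_def)
  qed
  show ?thesis
  proof (intro exI[of _ c] conjI)
    show "c = 0 \<or> (\<forall>i\<in>T. (\<Sum>j\<in>T. A $ i $ j) = 1)"
      using max all by blast
    show "0 \<le> c" using i0(2) by auto
  qed (use all in simp)
qed

text \<open>The second claim is the equality case of the triangle inequality: \<open>x i\<close> has
  modulus \<open>c\<close> and is a sum of terms whose moduli \<open>A $ i $ j * c\<close> add up to
  at most \<open>c\<close>, so no term has the opposite sign.\<close>

lemma signed_harmonic:
  fixes A :: "real^'v^'v" and x :: "'v \<Rightarrow> real"
  assumes A: "stochastic_matrix A" and T: "T \<in> level_classes A m"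
    and P: "\<And>i j. i \<in> T \<Longrightarrow> j \<in> T \<Longrightarrow> \<bar>P i j\<bar> = A $ i $ j"
    and harmonic: "\<And>i. i \<in> T \<Longrightarrow> x i = (\<Sum>j\<in>T. P i j * x j)"
  shows "\<exists>c\<ge>0. (\<forall>i\<in>T. \<bar>x i\<bar> = c) \<and> (c = 0 \<or> (\<forall>i\<in>T. (\<Sum>j\<in>T. A $ i $ j) = 1))"
    and "\<And>i j. i \<in> T \<Longrightarrow> j \<in> T \<Longrightarrow> P i j * x j = A $ i $ j * x i"
proof -
  have "\<bar>x i\<bar> \<le> (\<Sum>j\<in>T. A $ i $ j * \<bar>x j\<bar>)" if "i \<in> T" for i
  proof -
    have "\<bar>x i\<bar> \<le> (\<Sum>j\<in>T. \<bar>P i j * x j\<bar>)" by (subst harmonic[OF that]) (rule sum_abs)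
    also have "\<dots> = (\<Sum>j\<in>T. A $ i $ j * \<bar>x j\<bar>)" using P that by (intro sum.cong) (auto simp: abs_mult)
    finally show ?thesis .
  qed
  from level_class_abs_const[OF A T this]
  show *: "\<exists>c\<ge>0. (\<forall>i\<in>T. \<bar>x i\<bar> = c) \<and> (c = 0 \<or> (\<forall>i\<in>T. (\<Sum>j\<in>T. A $ i $ j) = 1))"
    by blast
  then obtain c where c: "c \<ge> 0" "\<And>i. i \<in> T \<Longrightarrow> \<bar>x i\<bar> = c"
    "c = 0 \<or> (\<forall>i\<in>T. (\<Sum>j\<in>T. A $ i $ j) = 1)" by blast
  fix i j assume i: "i \<in> T" and j: "j \<in> T"
  show "P i j * x j = A $ i $ j * x i"
  proof (cases "c = 0")
    case True
    then show ?thesis using c(2)[OF i] c(2)[OF j] by simp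
  next
    case False
    \<comment> \<open>Multiplying by \<open>x i\<close> turns the comparison of signs into one of
      numbers: each \<open>d j\<close> is nonnegative and their sum is 0.\<close>
    define d where "d j = A $ i $ j * x i * x i - P i j * x j * x i" for j
    have sq: "x i * x i = c * c" using c(2)[OF i] by (metis abs_mult_self_eq)
    have "(\<Sum>j\<in>T. d j) = (\<Sum>j\<in>T. A $ i $ j) * (x i * x i) - (\<Sum>j\<in>T. P i j * x j) * x i"
      by (simp add: d_def sum_subtractf sum_distrib_right mult.assoc)
    also have "\<dots> = 0" using c(3) False i harmonic[OF i] by simp
    finally have sum0: "(\<Sum>j\<in>T. d j) = 0" .
    have nonneg: "0 \<le> d k" if "k \<in> T" for k
    proof -
      have "\<bar>P i k * x k * x i\<bar> = A $ i $ k * (c * c)"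
        using P[OF i that] c(2)[OF i] c(2)[OF that] by (simp add: abs_mult)
      then have "P i k * x k * x i \<le> A $ i $ k * (c * c)" by (metis abs_ge_self)
      then show ?thesis by (simp add: d_def mult.assoc sq)
    qed
    have "d j = 0" using sum_nonneg_eq_0_iff[of T d] sum0 nonneg j by auto
    moreover have "x i \<noteq> 0" using c(2)[OF i] False by auto
    ultimately show ?thesis by (simp add: d_def)
  qed
qed

text \<open>Padding the block with the identity outside \<open>T\<close> gives a square matrix over
  all agents that is injective along with the block; the entries of its inverse in
  \<open>T \<times> T\<close> invert the block.\<close>

lemma block_inverse_exists:
  fixes K :: "real^'v^'v"
  assumes inj: "\<And>u i. \<forall>i\<in>T. (\<Sum>j\<in>T. K $ i $ j * u $ j) = 0 \<Longrightarrow> i \<in> T \<Longrightarrow> u $ i = 0"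
  shows "\<exists>L. block_inverse T K L"
proof -
  define K' :: "real^'v^'v" where
    "K' = (\<chi> i j. if i \<in> T \<and> j \<in> T then K $ i $ j else if i = j then 1 else 0)"
  have K'T: "(\<Sum>j\<in>UNIV. K' $ i $ j * f j) = (\<Sum>j\<in>T. K $ i $ j * f j)" if "i \<in> T" for i f
  proof -
    have "(\<Sum>j\<in>UNIV. K' $ i $ j * f j) = (\<Sum>j\<in>T. K' $ i $ j * f j)"
      using that by (intro sum.mono_neutral_right) (auto simp: K'_def)
    then show ?thesis using that by (simp add: K'_def)
  qed
  have K'T': "(\<Sum>k\<in>UNIV. f k * K' $ k $ j) = (\<Sum>k\<in>T. f k * K $ k $ j)" if "j \<in> T" for j f
  proof -
    have "(\<Sum>k\<in>UNIV. f k * K' $ k $ j) = (\<Sum>k\<in>T. f k * K' $ k $ j)"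
      using that by (intro sum.mono_neutral_right) (auto simp: K'_def)
    then show ?thesis using that by (simp add: K'_def)
  qed
  have K'out: "(\<Sum>j\<in>UNIV. K' $ i $ j * f j) = f i" if "i \<notin> T" for i f
  proof -
    have "(\<Sum>j\<in>UNIV. K' $ i $ j * f j) = (\<Sum>j\<in>UNIV. if i = j then f j else 0)"
      using that by (intro sum.cong) (auto simp: K'_def)
    then show ?thesis by simp
  qed
  have "inj ((*v) K')"
  proof (subst linear_injective_0[OF matrix_vector_mul_linear], intro allI impI)
    fix u assume "K' *v u = 0"
    then have u: "(\<Sum>j\<in>UNIV. K' $ i $ j * u $ j) = 0" for i
      by (simp add: vec_eq_iff matrix_vector_mult_def)
    have "u $ i = 0" for i
      using inj[of u i] u K'T[of _ "\<lambda>j. u $ j"] K'out[of _ "\<lambda>j. u $ j"] by (cases "i \<in> T") auto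
    then show "u = 0" by (simp add: vec_eq_iff)
  qed
  then obtain L where L: "L ** K' = mat 1"
    using matrix_left_invertible_injective by blast
  then have L': "K' ** L = mat 1" by (simp add: matrix_left_right_inverse)
  have "block_inverse T K L"
    unfolding block_inverse_def
  proof (intro ballI conjI)
    fix i j assume "i \<in> T" "j \<in> T"
    then show "(\<Sum>k\<in>T. K $ i $ k * L $ k $ j) = (if i = j then 1 else 0)"
      "(\<Sum>k\<in>T. L $ i $ k * K $ k $ j) = (if i = j then 1 else 0)"
      using L L' K'T[of i "\<lambda>k. L $ k $ j"] K'T'[of j "\<lambda>k. L $ i $ k"]
      by (simp_all add: vec_eq_iff matrix_matrix_mult_def mat_def)
  qed
  then show ?thesis by blast
qed

lemma block_inverse_solve:
  assumes L: "block_inverse T K L" and T: "finite T"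
    and eq: "\<And>j. j \<in> T \<Longrightarrow> (\<Sum>k\<in>T. K $ j $ k * z $ k) = - b j" and i: "i \<in> T"
  shows "z $ i = - (\<Sum>j\<in>T. L $ i $ j * b j)"
proof -
  have "z $ i = (\<Sum>k\<in>T. (if i = k then 1 else 0) * z $ k)"
    using i T by (simp add: if_distrib[of "\<lambda>x. x * _"] sum.delta' cong: if_cong)
  also have "\<dots> = (\<Sum>k\<in>T. (\<Sum>j\<in>T. L $ i $ j * K $ j $ k) * z $ k)"
    using L i by (intro sum.cong) (auto simp: block_inverse_def)
  also have "\<dots> = (\<Sum>j\<in>T. L $ i $ j * (\<Sum>k\<in>T. K $ j $ k * z $ k))"
    by (simp add: sum_distrib_left sum_distrib_right mult.assoc) (rule sum.swap)
  also have "\<dots> = (\<Sum>j\<in>T. L $ i $ j * - b j)"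
    by (intro sum.cong) (auto simp: eq)
  finally show ?thesis by (simp add: sum_negf)
qed

text \<open>For a class of uniform attitude both formulas for \<open>K\<close> are the signed
  interaction minus the identity, so one argument serves competitive and cooperative
  classes.\<close>

lemma K_matrix_entry:
  "K_matrix cmp A $ i $ j = interaction A (\<lambda>_. cmp) $ i $ j - (if i = j then 1 else 0)"
  by (simp add: K_matrix_def interaction_def diag_part_def mat_def)

text \<open>A null vector of the block is harmonic on \<open>T\<close>, so its entries share one
  modulus, which is 0 as soon as some row of the block of \<open>A\<close> has sum below 1. Such a
  row exists, since some agent of \<open>T\<close> gives weight to the level just below.\<close>

lemma level_class_block_inverse:
  fixes A :: "real^'v^'v"
  assumes A: "stochastic_matrix A" and T: "T \<in> level_classes A m" and m: "m \<ge> 1"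
  shows "\<exists>L. block_inverse T (K_matrix cmp A) L"
proof (rule block_inverse_exists)
  fix u i assume u: "\<forall>i\<in>T. (\<Sum>j\<in>T. K_matrix cmp A $ i $ j * u $ j) = 0" and i: "i \<in> T"
  let ?P = "\<lambda>i j. interaction A (\<lambda>_. cmp) $ i $ j"
  have harm: "u $ i = (\<Sum>j\<in>T. ?P i j * u $ j)" if "i \<in> T" for i
  proof -
    have "(\<Sum>j\<in>T. K_matrix cmp A $ i $ j * u $ j)
      = (\<Sum>j\<in>T. ?P i j * u $ j) - (\<Sum>j\<in>T. if i = j then u $ j else 0)"
      unfolding sum_subtractf[symmetric] by (intro sum.cong) (auto simp: K_matrix_entry algebra_simps)
    then show ?thesis using u that by simp
  qed
  obtain c where c: "\<forall>i\<in>T. \<bar>u $ i\<bar> = c" "c = 0 \<or> (\<forall>i\<in>T. (\<Sum>j\<in>T. A $ i $ j) = 1)"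
    using signed_harmonic(1)[OF A T abs_interaction[OF A] harm] by blast
  obtain n where n: "m = Suc n" using m by (cases m) auto
  then obtain k l where kl: "k \<in> T" "l \<in> \<Union>(level_classes A n)" "A $ k $ l > 0" using T by auto
  then have "l \<notin> T" using T level_class_disjoint[of _ A n T m] n by blast
  have "(\<Sum>j\<in>T. A $ k $ j) + A $ k $ l = (\<Sum>j\<in>insert l T. A $ k $ j)"
    using \<open>l \<notin> T\<close> by simp
  also have "\<dots> \<le> 1" by (rule stochastic_matrix_subset_sum_le[OF A])
  finally show "u $ i = 0" using c kl i by force
qed

text \<open>Classes of lower levels are pairwise disjoint, and agents of \<open>T\<close> give no
  weight outside \<open>T\<close> and these levels, so the sums over classes regroup into a single
  one.\<close>

lemma level_class_sum_lower:
  fixes A :: "real^'v^'v"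
  assumes T: "T \<in> level_classes A m" and m: "m \<ge> 1" and i: "i \<in> T"
  shows "(\<Sum>R\<in>level_classes A 0. block_mult (B_tilde cmp A) R z i)
      + (\<Sum>t\<in>{1..<m}. \<Sum>S\<in>level_classes A t. block_mult (B_tilde cmp A) S z i)
    = (\<Sum>j\<in>-T. B_tilde cmp A $ i $ j * z $ j)"
proof -
  let ?f = "\<lambda>j. B_tilde cmp A $ i $ j * z $ j" and ?L = "\<lambda>t. \<Union>(level_classes A t)"
  have fin: "finite (level_classes A t)" for t
    by (rule finite_subset[of _ UNIV]) auto
  have "(\<Sum>R\<in>level_classes A 0. block_mult (B_tilde cmp A) R z i)
      + (\<Sum>t\<in>{1..<m}. \<Sum>S\<in>level_classes A t. block_mult (B_tilde cmp A) S z i)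
    = (\<Sum>t\<in>insert 0 {1..<m}. \<Sum>S\<in>level_classes A t. block_mult (B_tilde cmp A) S z i)"
    by simp
  also have "insert 0 {1..<m} = {..<m}" using m by auto
  also have "(\<Sum>t<m. \<Sum>S\<in>level_classes A t. block_mult (B_tilde cmp A) S z i) = (\<Sum>t<m. \<Sum>j\<in>?L t. ?f j)"
  proof (intro sum.cong refl)
    fix t
    show "(\<Sum>S\<in>level_classes A t. block_mult (B_tilde cmp A) S z i) = (\<Sum>j\<in>?L t. ?f j)"
      unfolding block_mult_def
      using sum.Union_disjoint[of "level_classes A t" ?f] level_class_unique[of _ A t]
      by (simp add: disjoint_iff) metis
  qed
  also have "\<dots> = (\<Sum>j\<in>(\<Union>t\<in>{..<m}. ?L t). ?f j)"
  proof (rule sum.UNION_disjoint[symmetric])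
    have "?L s \<inter> ?L t = {}" if "s < t" for s t
      using level_class_disjoint[OF _ _ that, of _ A] by fast
    then show "\<forall>s\<in>{..<m}. \<forall>t\<in>{..<m}. s \<noteq> t \<longrightarrow> ?L s \<inter> ?L t = {}"
      by (metis inf_commute linorder_neqE_nat)
  qed auto
  also have "\<dots> = (\<Sum>j\<in>-T. ?f j)"
  proof (rule sum.mono_neutral_left)
    obtain n where n: "m = Suc n" using m by (cases m) auto
    have "{..<m} = {..n}" using n by auto
    then show "(\<Union>t\<in>{..<m}. ?L t) \<subseteq> - T" "\<forall>j\<in>- T - (\<Union>t\<in>{..<m}. ?L t). ?f j = 0"
      using T i by (auto simp: n B_tilde_def)
  qed auto
  finally show ?thesis .
qed

section \<open>Stationary vectors and equilibria\<close>

text \<open>Brouwer's theorem for \<open>v \<mapsto> v A\<close> on the simplex of weights supported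
  in \<open>R\<close>, which is mapped into itself because \<open>R\<close> is closed. Some weight
  is positive as the total is 1, and positivity spreads along the edges.\<close>

lemma closed_class_stationary:
  fixes A :: "real^'v^'v"
  assumes A: "stochastic_matrix A" and R: "R \<in> level_classes A 0"
  shows "\<exists>\<pi>. (\<forall>i\<in>R. \<pi> i > 0) \<and> (\<forall>j\<in>R. (\<Sum>i\<in>R. \<pi> i * A $ i $ j) = \<pi> j)"
proof -
  have closed: "A $ i $ j = 0" if "i \<in> R" "j \<notin> R" for i j using R that by auto
  have nn: "0 \<le> A $ i $ j" for i j by (rule stochastic_matrix_nonneg[OF A])
  define u :: "real^'v" where "u = (\<chi> i. if i \<in> R then 1 else 0)"
  \<comment> \<open>The upper corner \<open>u\<close> is 0 outside \<open>R\<close>, so the box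
    already encodes the support condition, and compactness and convexity are immediate.\<close>
  define S where "S = cbox 0 u \<inter> {v. (\<Sum>i\<in>UNIV. v $ i) = 1}"
  have S_iff: "v \<in> S \<longleftrightarrow> (\<forall>i. 0 \<le> v $ i \<and> v $ i \<le> (if i \<in> R then 1 else 0)) \<and> (\<Sum>i\<in>UNIV. v $ i) = 1" for v
    by (simp add: S_def mem_box_cart u_def)
  have "closed {v::real^'v. (\<Sum>i\<in>UNIV. v $ i) = 1}"
    by (intro closed_Collect_eq continuous_intros)
  then have "compact S" unfolding S_def by (intro compact_Int_closed compact_cbox)
  moreover have "convex S"
    unfolding S_def
  proof (intro convex_Int convex_box)
    show "convex {v::real^'v. (\<Sum>i\<in>UNIV. v $ i) = 1}"
      by (rule convexI) (simp add: sum.distrib sum_distrib_left[symmetric])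
  qed
  moreover obtain r0 where r0: "r0 \<in> R" using level_class_nonempty[OF R] by auto
  have "axis r0 1 \<in> S" using r0 by (auto simp: S_iff axis_def)
  then have "S \<noteq> {}" by blast
  moreover have "continuous_on S (\<lambda>v. v v* A)"
    unfolding vector_matrix_mult_def by (intro continuous_intros continuous_on_vec_lambda)
  moreover have "(\<lambda>v. v v* A) \<in> S \<rightarrow> S"
  proof
    fix v assume v: "v \<in> S"
    then have v0: "v $ i = 0" if "i \<notin> R" for i
      using that unfolding S_iff by (metis order_antisym)
    have vn: "0 \<le> v $ i" for i using v by (simp add: S_iff)
    have entry: "(v v* A) $ j = (\<Sum>i\<in>UNIV. v $ i * A $ i $ j)" for j
      by (simp add: vector_matrix_mult_def mult.commute)
    have sum: "(\<Sum>j\<in>UNIV. (v v* A) $ j) = 1"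
    proof -
      have "(\<Sum>j\<in>UNIV. (v v* A) $ j) = (\<Sum>i\<in>UNIV. v $ i * (\<Sum>j\<in>UNIV. A $ i $ j))"
        unfolding entry sum_distrib_left by (rule sum.swap)
      then show ?thesis using v stochastic_matrix_row_sum[OF A] by (simp add: S_iff)
    qed
    have nonneg: "0 \<le> (v v* A) $ j" for j unfolding entry by (intro sum_nonneg mult_nonneg_nonneg vn nn)
    have "(v v* A) $ j \<le> (if j \<in> R then 1 else 0)" for j
    proof (cases "j \<in> R")
      case True
      have "(v v* A) $ j \<le> (\<Sum>j\<in>UNIV. (v v* A) $ j)" by (rule member_le_sum) (auto simp: nonneg)
      then show ?thesis using True sum by simp
    next
      case False
      then have "v $ i * A $ i $ j = 0" for i using v0[of i] closed[of i j] by auto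
      then have "(\<Sum>i\<in>UNIV. v $ i * A $ i $ j) = 0" by (intro sum.neutral) simp
      then show ?thesis using False by (simp add: entry)
    qed
    then show "v v* A \<in> S" using nonneg sum by (simp add: S_iff)
  qed
  ultimately obtain v where v: "v \<in> S" "v v* A = v"
    using brouwer[of S "\<lambda>v. v v* A"] by blast
  have vn: "0 \<le> v $ i" for i using v by (simp add: S_iff)
  have v0: "v $ i = 0" if "i \<notin> R" for i
    using v(1) that unfolding S_iff by (metis order_antisym)
  have inv: "(\<Sum>i\<in>R. v $ i * A $ i $ j) = v $ j" for j
  proof -
    have "v $ j = (v v* A) $ j" using v(2) by simp
    also have "\<dots> = (\<Sum>i\<in>UNIV. v $ i * A $ i $ j)" by (simp add: vector_matrix_mult_def mult.commute)
    also have "\<dots> = (\<Sum>i\<in>R. v $ i * A $ i $ j)"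
      by (intro sum.mono_neutral_right) (auto simp: v0)
    finally show ?thesis by simp
  qed
  have "\<exists>i. v $ i \<noteq> 0"
  proof (rule ccontr)
    assume "\<not> ?thesis"
    then show False using v(1) by (simp add: S_iff)
  qed
  then obtain i0 where "v $ i0 \<noteq> 0" by blast
  then have i0: "i0 \<in> R" "v $ i0 > 0" using v0 vn[of i0] by force+
  have "v $ i > 0" if "i \<in> R" for i
  proof (rule level_class_induct[where Q="\<lambda>j. v $ j > 0", OF R i0(1) i0(2) _ that])
    fix k l assume kl: "k \<in> R" "l \<in> R" "(k, l) \<in> edges A" "v $ k > 0"
    have "0 < v $ k * A $ k $ l" using kl nn[of k l] by (simp add: edges_def less_le)
    also have "\<dots> \<le> (\<Sum>i\<in>R. v $ i * A $ i $ l)"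
      using kl(1) by (intro member_le_sum[of k R "\<lambda>i. v $ i * A $ i $ l"]) (auto intro: mult_nonneg_nonneg vn nn)
    finally show "v $ l > 0" by (simp add: inv)
  qed
  then show ?thesis using inv by (intro exI[of _ "\<lambda>i. v $ i"]) auto
qed

text \<open>The shape of the limit is a deterministic matter: it is derived for every fixed point of
  the draw probabilities, and almost every path converges to one.\<close>

locale equilibrium =
  fixes A :: "real^'v^'v" and competitive :: "'v \<Rightarrow> bool" and z :: "real^'v"
  assumes stochastic: "stochastic_matrix A"
    and fixed: "\<And>i. draw_prob A competitive z i = z $ i"
begin

abbreviation x :: "'v \<Rightarrow> real" where "x i \<equiv> z $ i - 1 / 2"

lemma harmonic: "x i = (\<Sum>j\<in>UNIV. interaction A competitive $ i $ j * x j)"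
  using draw_prob_centred[OF stochastic, of competitive z i] by (simp add: fixed)

lemma harmonic_closed:
  assumes R: "R \<in> level_classes A 0" and i: "i \<in> R"
  shows "x i = (\<Sum>j\<in>R. interaction A competitive $ i $ j * x j)"
  unfolding harmonic[of i] using R i
  by (intro sum.mono_neutral_right) (auto simp: interaction_def)

text \<open>The equality case of the triangle inequality fixes each term of the average; on an edge
  the weight is nonzero and cancels.\<close>

lemma closed_edge:
  assumes R: "R \<in> level_classes A 0" and "k \<in> R" "l \<in> R" "(k, l) \<in> edges A"
  shows "x l = (if competitive k then - x k else x k)"
proof -
  have "interaction A competitive $ k $ l * x l = A $ k $ l * x k"
    by (rule signed_harmonic(2)[OF stochastic R abs_interaction[OF stochastic] harmonic_closed[OF R] assms(2,3)])
  moreover have "interaction A competitive $ k $ l = A $ k $ l * (if competitive k then - 1 else 1)"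
    using assms(4) by (simp add: interaction_def edges_def)
  ultimately have "A $ k $ l * ((if competitive k then - 1 else 1) * x l) = A $ k $ l * x k"
    by (simp only: mult.assoc)
  moreover have "A $ k $ l \<noteq> 0" using assms(4) by (simp add: edges_def)
  ultimately have "(if competitive k then - 1 else 1) * x l = x k" by (simp only: mult_cancel_left simp_thms)
  then show ?thesis by (simp split: if_splits)
qed

lemma cooperative_closed_const:
  assumes R: "R \<in> level_classes A 0" and coop: "\<forall>i\<in>R. \<not> competitive i"
    and "i \<in> R" "j \<in> R"
  shows "z $ i = z $ j"
  by (rule level_class_induct[where Q="\<lambda>j. z $ i = z $ j", OF R assms(3) refl _ assms(4)])
    (use closed_edge[OF R] coop in fastforce)

text \<open>Each edge both reverses the centred state and changes sides, so the state depends on the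
  side only.\<close>

lemma competitive_closed_bipartite:
  assumes R: "R \<in> level_classes A 0" and comp: "\<forall>i\<in>R. competitive i"
    and bip: "bipartition R (edges A \<inter> R \<times> R) V1 V2" and i: "i \<in> V1"
  shows "j \<in> V1 \<Longrightarrow> z $ j = z $ i" and "j \<in> V2 \<Longrightarrow> z $ j = 1 - z $ i"
proof -
  have V: "V1 \<inter> V2 = {}" "V1 \<union> V2 = R"
    "\<And>k l. (k, l) \<in> edges A \<Longrightarrow> k \<in> R \<Longrightarrow> l \<in> R \<Longrightarrow> (k \<in> V1 \<and> l \<in> V2) \<or> (k \<in> V2 \<and> l \<in> V1)"
    using bip by (auto simp: bipartition_def)
  define Q where "Q j \<longleftrightarrow> x j = (if j \<in> V1 then x i else - x i)" for j
  have "Q j" if "j \<in> R" for j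
  proof (rule level_class_induct[where Q=Q, OF R _ _ _ that])
    show "i \<in> R" "Q i" using i V by (auto simp: Q_def)
    fix k l assume kl: "k \<in> R" "l \<in> R" "(k, l) \<in> edges A" "Q k"
    have "x l = - x k" using closed_edge[OF R kl(1-3)] comp kl(1) by simp
    moreover have "(k \<in> V1 \<and> l \<notin> V1) \<or> (k \<notin> V1 \<and> l \<in> V1)" using V(1) V(3)[OF kl(3,1,2)] by blast
    ultimately show "Q l" using kl(4) by (auto simp: Q_def)
  qed
  then have Q: "x j = (if j \<in> V1 then x i else - x i)" if "j \<in> R" for j
    using that by (simp add: Q_def)
  show "z $ j = z $ i" if "j \<in> V1" using Q[of j] that V(2) by auto
  show "z $ j = 1 - z $ i" if "j \<in> V2"
  proof -
    have "j \<in> R" "j \<notin> V1" using that V(1,2) by auto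
    then show ?thesis using Q[of j] by simp
  qed
qed

text \<open>If the common modulus of the centred states were positive, their signs would alternate
  along every edge, and the positive and the negative agents would form a bipartition.\<close>

lemma competitive_closed_not_bipartite:
  assumes R: "R \<in> level_classes A 0" and comp: "\<forall>i\<in>R. competitive i" and card: "2 \<le> card R"
    and nbip: "\<not> bipartite R (edges A \<inter> R \<times> R)" and i: "i \<in> R"
  shows "z $ i = 1 / 2"
proof (rule ccontr)
  assume ne: "z $ i \<noteq> 1 / 2"
  obtain c where c: "\<forall>i\<in>R. \<bar>x i\<bar> = c"
    using signed_harmonic(1)[OF stochastic R abs_interaction[OF stochastic] harmonic_closed[OF R]] by blast
  have c0: "c > 0" using c i ne by fastforce
  have flip: "x l = - x k" if "k \<in> R" "l \<in> R" "(k, l) \<in> edges A" for k l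
    using closed_edge[OF R that] comp that(1) by simp
  \<comment> \<open>A lone closed agent has all its weight on itself and no edge: it counts as not
    bipartite, yet every value is an equilibrium. With at least two agents connectedness gives an
    edge, so both sign sets are inhabited.\<close>
  have "\<exists>l\<in>R. (i, l) \<in> edges A"
  proof (rule ccontr)
    assume no: "\<not> ?thesis"
    have "j = i" if "j \<in> R" for j
      by (rule level_class_induct[where Q="\<lambda>j. j = i", OF R i refl _ that]) (use no in auto)
    then have "R \<subseteq> {i}" by auto
    then have "card R \<le> 1" using card_mono[of "{i}" R] by simp
    with card show False by simp
  qed
  then obtain l where l: "l \<in> R" "(i, l) \<in> edges A" by blast
  define V1 V2 where "V1 = {j\<in>R. x j > 0}" and "V2 = {j\<in>R. x j < 0}"
  have pos_or_neg: "x j > 0 \<or> x j < 0" if "j \<in> R" for j using c c0 that by fastforce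
  then have "V1 \<union> V2 = R" by (auto simp: V1_def V2_def)
  moreover have alternate: "(k \<in> V1 \<and> m \<in> V2) \<or> (k \<in> V2 \<and> m \<in> V1)"
    if "k \<in> R" "m \<in> R" "(k, m) \<in> edges A" for k m
    using flip[OF that] that pos_or_neg[OF that(1)] by (auto simp: V1_def V2_def)
  moreover have "V1 \<noteq> {}" "V2 \<noteq> {}"
    using alternate[OF i l] by auto
  moreover have "V1 \<inter> V2 = {}" by (auto simp: V1_def V2_def)
  ultimately have "bipartite R (edges A \<inter> R \<times> R)"
    unfolding bipartite_def bipartition_def by blast
  with nbip show False by simp
qed

lemma transient_class_equation:
  assumes T: "T \<in> level_classes A m" and m: "m \<ge> 1" and cmp: "\<forall>i\<in>T. competitive i = cmp"
    and L: "block_inverse T (K_matrix cmp A) L" and i: "i \<in> T"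
  shows "z $ i = - (\<Sum>j\<in>T. L $ i $ j * (c_vector cmp A $ j
      + (\<Sum>R\<in>level_classes A 0. block_mult (B_tilde cmp A) R z j)
      + (\<Sum>t\<in>{1..<m}. \<Sum>S\<in>level_classes A t. block_mult (B_tilde cmp A) S z j)))"
proof (rule block_inverse_solve[OF L _ _ i])
  fix j assume j: "j \<in> T"
  let ?P = "\<lambda>k. interaction A (\<lambda>_. cmp) $ j $ k"
  have split: "(\<Sum>k\<in>UNIV. f k) = (\<Sum>k\<in>T. f k) + (\<Sum>k\<in>-T. f k)" for f :: "'v \<Rightarrow> real"
    using sum.union_disjoint[of T "- T" f] by simp
  \<comment> \<open>The signed row sum falls short of 1 by twice the constant term:
    \<open>c_vector\<close> is what centring at 1/2 leaves behind.\<close>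
  have row: "(\<Sum>k\<in>UNIV. ?P k) = 1 - 2 * c_vector cmp A $ j"
  proof -
    have "(\<Sum>k\<in>UNIV. ?P k) = A $ j $ j + (\<Sum>k\<in>UNIV - {j}. if cmp then - A $ j $ k else A $ j $ k)"
      by (subst sum.remove[of UNIV j]) (auto simp: interaction_def intro!: sum.cong)
    moreover have "A $ j $ j + (\<Sum>k\<in>UNIV - {j}. A $ j $ k) = 1"
      using stochastic_matrix_row_sum[OF stochastic, of j] by (simp add: sum.remove[of UNIV j])
    ultimately show ?thesis by (auto simp: c_vector_def sum_negf)
  qed
  have "x j = (\<Sum>k\<in>UNIV. interaction A competitive $ j $ k * x k)" by (rule harmonic)
  also have "\<dots> = (\<Sum>k\<in>UNIV. ?P k * z $ k) - (\<Sum>k\<in>UNIV. ?P k) / 2"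
    using cmp j by (simp add: interaction_def algebra_simps sum_subtractf sum_divide_distrib)
  finally have zj: "z $ j = (\<Sum>k\<in>UNIV. ?P k * z $ k) + c_vector cmp A $ j"
    unfolding row by (simp add: field_simps)
  have "(\<Sum>k\<in>T. K_matrix cmp A $ j $ k * z $ k) = (\<Sum>k\<in>T. ?P k * z $ k) - (\<Sum>k\<in>T. if j = k then z $ k else 0)"
    unfolding sum_subtractf[symmetric] by (intro sum.cong) (auto simp: K_matrix_entry algebra_simps)
  also have "\<dots> = (\<Sum>k\<in>T. ?P k * z $ k) - z $ j" using j by simp
  also have "\<dots> = - (c_vector cmp A $ j + (\<Sum>k\<in>-T. ?P k * z $ k))"
    using zj split[of "\<lambda>k. ?P k * z $ k"] by simp
  also have "(\<Sum>k\<in>-T. ?P k * z $ k) = (\<Sum>k\<in>-T. B_tilde cmp A $ j $ k * z $ k)"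
    using j by (intro sum.cong) (auto simp: B_tilde_def interaction_def)
  also have "\<dots> = (\<Sum>R\<in>level_classes A 0. block_mult (B_tilde cmp A) R z j)
      + (\<Sum>t\<in>{1..<m}. \<Sum>S\<in>level_classes A t. block_mult (B_tilde cmp A) S z j)"
    by (rule level_class_sum_lower[OF T m j, symmetric])
  finally show "(\<Sum>k\<in>T. K_matrix cmp A $ j $ k * z $ k)
    = - (c_vector cmp A $ j
      + (\<Sum>R\<in>level_classes A 0. block_mult (B_tilde cmp A) R z j)
      + (\<Sum>t\<in>{1..<m}. \<Sum>S\<in>level_classes A t. block_mult (B_tilde cmp A) S z j))"
    by (simp only: add.assoc)
qed simp

end

section \<open>Almost sure convergence of the states\<close>

lemma draw_prob_range:
  fixes A :: "real^'v^'v"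
  assumes "stochastic_matrix A" "\<And>j. z $ j \<in> {0..1}"
  shows "draw_prob A competitive z i \<in> {0..1}"
proof -
  have "\<bar>draw_prob A competitive z i - 1 / 2\<bar> \<le> (\<Sum>j\<in>UNIV. \<bar>interaction A competitive $ i $ j * (z $ j - 1 / 2)\<bar>)"
    unfolding draw_prob_centred[OF assms(1)] by (rule sum_abs)
  also have "\<dots> \<le> (\<Sum>j\<in>UNIV. A $ i $ j * (1 / 2))"
  proof (rule sum_mono)
    fix j
    have "\<bar>z $ j - 1 / 2\<bar> \<le> 1 / 2" using assms(2)[of j] by (simp add: abs_if field_simps)
    then show "\<bar>interaction A competitive $ i $ j * (z $ j - 1 / 2)\<bar> \<le> A $ i $ j * (1 / 2)"
      unfolding abs_mult abs_interaction[OF assms(1)]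
      by (intro mult_left_mono stochastic_matrix_nonneg[OF assms(1)])
  qed
  also have "\<dots> = 1 / 2"
    unfolding sum_distrib_right[symmetric] stochastic_matrix_row_sum[OF assms(1)] by simp
  finally have "0 \<le> draw_prob A competitive z i" "draw_prob A competitive z i \<le> 1"
    by linarith+
  then show ?thesis by simp
qed

lemma summable_vec:
  fixes f :: "nat \<Rightarrow> real^'n"
  assumes "\<And>i. summable (\<lambda>n. f n $ i)"
  shows "summable f"
proof -
  have "f n = (\<Sum>i\<in>UNIV. (f n $ i) *\<^sub>R axis i 1)" for n
    using basis_expansion[of "f n"] by (simp add: scalar_mult_eq_scaleR)
  moreover have "summable (\<lambda>n. \<Sum>i\<in>UNIV. (f n $ i) *\<^sub>R axis i (1::real))"
    by (intro summable_sum bounded_linear.summable[OF bounded_linear_scaleR_left] assms)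
  ultimately show ?thesis by simp
qed

context interacting_agents
begin

abbreviation P :: "real^'v^'v" where "P \<equiv> interaction A competitive"

abbreviation F :: "nat \<Rightarrow> 'a measure" where "F \<equiv> history M Y"

text \<open>The states are not assumed measurable for the histories, whereas this version of the
  draw probability is. It replaces \<open>draw_prob\<close>, with which it agrees almost surely,
  wherever a function of the past is required.\<close>

definition p :: "nat \<Rightarrow> 'v \<Rightarrow> 'a \<Rightarrow> real" where
  "p n i = real_cond_exp M (F n) (indicator {\<omega> \<in> space M. Y (Suc n) \<omega> $ i = 1})"

lemma space_history: "space (F n) = space M"
  by (simp add: history_def space_measure_of_conv)

lemma sets_history:
  "sets (F n) = sigma_sets (space M) {Y k -` B \<inter> space M | k B. k \<le> n \<and> B \<in> sets borel}"
  unfolding history_def by (rule sets_measure_of) auto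

lemma subalgebra_history: "subalgebra M (F n)"
  unfolding subalgebra_def sets_history space_history
  using Y_measurable by (auto intro!: sets.sigma_sets_subset measurable_sets)

lemma sets_history_Suc: "sets (F n) \<subseteq> sets (F (Suc n))"
  unfolding sets_history by (intro sigma_sets_mono') (auto intro: le_SucI)

lemma Y_measurable_history: "k \<le> n \<Longrightarrow> Y k \<in> borel_measurable (F n)"
  by (rule measurableI) (auto simp: space_history sets_history)

lemma subalgebra_history_Suc: "subalgebra (F (Suc n)) (F n)"
  by (simp add: subalgebra_def space_history sets_history_Suc)

lemma sigma_finite_history: "sigma_finite_subalgebra M (F n)"
  by (intro finite_measure_subalgebra_is_sigma_finite finite_measure_subalgebra.intro
      finite_measure_axioms finite_measure_subalgebra_axioms.intro subalgebra_history)

lemma p_measurable_history: "p n i \<in> borel_measurable (F n)"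
  by (simp add: p_def)

lemma Y_nth_measurable [measurable]: "(\<lambda>\<omega>. Y n \<omega> $ i) \<in> borel_measurable M"
  using measurable_compose[OF Y_measurable borel_measurable_nth] .

lemma Zbar_nth_measurable [measurable]: "(\<lambda>\<omega>. Zbar n \<omega> $ i) \<in> borel_measurable M"
  using measurable_compose[OF Zbar_measurable borel_measurable_nth] .

lemma p_measurable [measurable]: "p n i \<in> borel_measurable M"
  by (simp add: p_def)

lemma AE_p: "AE \<omega> in M. \<forall>n i. p n i \<omega> = draw_prob A competitive (Zbar n \<omega>) i"
  using Y_cond_prob by (simp add: AE_all_countable p_def)

lemma AE_p_range: "AE \<omega> in M. \<forall>n i. p n i \<omega> \<in> {0..1}"
  using AE_p AE_space
  by eventually_elim (simp only: draw_prob_range[OF stochastic Zbar_range] simp_thms)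

lemma Y_indicator:
  "\<omega> \<in> space M \<Longrightarrow> Y n \<omega> $ i = indicator {\<omega> \<in> space M. Y n \<omega> $ i = 1} \<omega>"
  using Y_range[of \<omega> n i] by (auto simp: indicator_def)

lemma integrable_bounded_mult:
  fixes f g :: "'a \<Rightarrow> real"
  assumes "f \<in> borel_measurable M" "g \<in> borel_measurable M"
    "AE \<omega> in M. \<bar>f \<omega>\<bar> \<le> b" "AE \<omega> in M. \<bar>g \<omega>\<bar> \<le> c"
  shows "integrable M (\<lambda>\<omega>. f \<omega> * g \<omega>)"
proof (rule integrable_const_bound[where B="b * c"])
  show "AE \<omega> in M. norm (f \<omega> * g \<omega>) \<le> b * c"
    using assms(3,4) by eventually_elim (simp add: abs_mult mult_mono')
qed (use assms in simp)

text \<open>The defining property of conditional expectation tested against \<open>g\<close>; the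
  bound on \<open>g\<close> supplies integrability.\<close>

lemma innovation_orthogonal:
  assumes g: "g \<in> borel_measurable (F n)" and bound: "AE \<omega> in M. \<bar>g \<omega>\<bar> \<le> b"
  shows "(\<integral>\<omega>. g \<omega> * (Y (Suc n) \<omega> $ i - p n i \<omega>) \<partial>M) = 0"
proof -
  let ?I = "indicator {\<omega> \<in> space M. Y (Suc n) \<omega> $ i = 1} :: 'a \<Rightarrow> real"
  have gM: "g \<in> borel_measurable M" using measurable_from_subalg[OF subalgebra_history g] .
  have I: "?I \<in> borel_measurable M" by measurable
  have int_I: "integrable M (\<lambda>\<omega>. g \<omega> * ?I \<omega>)"
    by (rule integrable_bounded_mult[OF gM I bound, of 1]) (simp add: indicator_def)
  have int_p: "integrable M (\<lambda>\<omega>. g \<omega> * p n i \<omega>)"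
    unfolding p_def by (rule sigma_finite_subalgebra.real_cond_exp_intg(1)[OF sigma_finite_history int_I g I])
  have "(\<integral>\<omega>. g \<omega> * (Y (Suc n) \<omega> $ i - p n i \<omega>) \<partial>M) = (\<integral>\<omega>. g \<omega> * ?I \<omega> - g \<omega> * p n i \<omega> \<partial>M)"
    by (intro Bochner_Integration.integral_cong) (simp_all add: Y_indicator[symmetric] right_diff_distrib)
  also have "\<dots> = (\<integral>\<omega>. g \<omega> * ?I \<omega> \<partial>M) - (\<integral>\<omega>. g \<omega> * p n i \<omega> \<partial>M)"
    by (intro Bochner_Integration.integral_diff int_I int_p)
  also have "(\<integral>\<omega>. g \<omega> * p n i \<omega> \<partial>M) = (\<integral>\<omega>. g \<omega> * ?I \<omega> \<partial>M)"
    unfolding p_def by (rule sigma_finite_subalgebra.real_cond_exp_intg(2)[OF sigma_finite_history int_I g I])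
  finally show ?thesis by simp
qed

lemma AE_innovation_bound: "AE \<omega> in M. \<forall>n i. \<bar>Y (Suc n) \<omega> $ i - p n i \<omega>\<bar> \<le> 1"
  using AE_p_range AE_space
proof eventually_elim
  case (elim \<omega>)
  show ?case
  proof (intro allI)
    fix n i
    have "Y (Suc n) \<omega> $ i \<in> {0, 1}" "p n i \<omega> \<in> {0..1}" using Y_range[OF elim(2)] elim(1) by auto
    then show "\<bar>Y (Suc n) \<omega> $ i - p n i \<omega>\<bar> \<le> 1" by auto
  qed
qed

lemma innovation_measurable_history:
  "(\<lambda>\<omega>. Y (Suc n) \<omega> $ i - p n i \<omega>) \<in> borel_measurable (F (Suc n))"
  by (intro borel_measurable_diff measurable_compose[OF Y_measurable_history borel_measurable_nth]
      measurable_from_subalg[OF subalgebra_history_Suc p_measurable_history] order_refl)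

lemma AE_summable_innovations:
  "AE \<omega> in M. summable (\<lambda>n. r n * (Y (Suc n) \<omega> $ i - p n i \<omega>))"
proof -
  interpret bounded_martingale_differences M F "\<lambda>n \<omega>. r n * (Y (Suc n) \<omega> $ i - p n i \<omega>)" r
  proof
    fix n
    show "subalgebra M (F n)" by (rule subalgebra_history)
    show "sets (F n) \<subseteq> sets (F (Suc n))" by (rule sets_history_Suc)
    show "(\<lambda>\<omega>. r n * (Y (Suc n) \<omega> $ i - p n i \<omega>)) \<in> borel_measurable (F (Suc n))"
      by (intro borel_measurable_times borel_measurable_const innovation_measurable_history)
    show "AE \<omega> in M. \<bar>r n * (Y (Suc n) \<omega> $ i - p n i \<omega>)\<bar> \<le> r n"
      using AE_innovation_bound
    proof eventually_elim
      case (elim \<omega>)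
      then show ?case using step_range[of n] mult_left_mono[of "\<bar>Y (Suc n) \<omega> $ i - p n i \<omega>\<bar>" 1 "r n"]
        by (simp add: abs_mult)
    qed
    fix g :: "'a \<Rightarrow> real" and b :: real
    assume "g \<in> borel_measurable (F n)" "AE \<omega> in M. \<bar>g \<omega>\<bar> \<le> b"
    from innovation_orthogonal[OF this, of i]
    show "(\<integral>\<omega>. g \<omega> * (r n * (Y (Suc n) \<omega> $ i - p n i \<omega>)) \<partial>M) = 0"
      by (simp add: mult.left_commute[of _ "r n"])
  qed
  show ?thesis by (rule AE_summable[OF step_square_summable])
qed

lemma step_tendsto_0: "r \<longlonglongrightarrow> 0"
proof -
  have "(\<lambda>n. sqrt ((r n)\<^sup>2)) \<longlonglongrightarrow> sqrt 0"
    by (intro tendsto_real_sqrt summable_LIMSEQ_zero step_square_summable)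
  moreover have "sqrt ((r n)\<^sup>2) = r n" for n using step_range[of n] by simp
  ultimately show ?thesis by simp
qed

text \<open>\<open>lim\<close> is defined on every path, so measurability needs no removal of a null
  set; where the states diverge the value is unspecified.\<close>

definition Zinf :: "'a \<Rightarrow> real^'v" where "Zinf \<omega> = lim (\<lambda>n. Zbar n \<omega>)"

lemma Zinf_measurable [measurable]: "Zinf \<in> borel_measurable M"
  unfolding Zinf_def[abs_def] using Zbar_measurable by measurable

text \<open>Off a null set the weighted innovations are summable and \<open>p\<close> equals the
  draw probability, so the deterministic convergence theorem applies path by path to the centred
  states.\<close>

theorem AE_convergence:
  "AE \<omega> in M. (\<lambda>n. Zbar n \<omega>) \<longlonglongrightarrow> Zinf \<omega> \<and> (\<forall>i. draw_prob A competitive (Zinf \<omega>) i = Zinf \<omega> $ i)"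
proof -
  interpret power_bounded "(*v) P" "real CARD('v)"
    by (rule power_bounded.intro[OF matrix_vector_mul_linear norm_interaction_power[OF stochastic]])
  have "AE \<omega> in M. \<forall>i. summable (\<lambda>n. r n * (Y (Suc n) \<omega> $ i - p n i \<omega>))"
    by (simp add: AE_all_countable AE_summable_innovations)
  then show ?thesis
    using AE_p AE_space
  proof eventually_elim
    case (elim \<omega>)
    define x :: "nat \<Rightarrow> real^'v" where "x n = (\<chi> i. Zbar n \<omega> $ i - 1 / 2)" for n
    define e :: "nat \<Rightarrow> real^'v" where "e n = (\<chi> i. Y (Suc n) \<omega> $ i - draw_prob A competitive (Zbar n \<omega>) i)" for n
    have drift: "draw_prob A competitive z i - 1 / 2 = (P *v (\<chi> j. z $ j - 1 / 2)) $ i" for z i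
      by (simp add: draw_prob_centred[OF stochastic] matrix_vector_mult_def)
    have "\<exists>l. P *v l = l \<and> x \<longlonglongrightarrow> l"
    proof (rule stochastic_approximation_converges[OF _ step_tendsto_0 step_diverges])
      show "0 \<le> r n" for n using step_range[of n] by simp
      show "summable (\<lambda>n. r n *\<^sub>R e n)"
        using elim(1,2) by (intro summable_vec) (simp add: e_def)
      show "x (Suc n) = x n + r n *\<^sub>R (P *v x n - x n + e n)" for n
      proof (rule vec_eq_iff[THEN iffD2], rule allI)
        fix i
        have px: "(P *v x n) $ i = draw_prob A competitive (Zbar n \<omega>) i - 1 / 2"
          "x n $ i = Zbar n \<omega> $ i - 1 / 2"
          by (simp_all add: drift x_def)
        show "x (Suc n) $ i = (x n + r n *\<^sub>R (P *v x n - x n + e n)) $ i"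
          by (simp add: px x_def[of "Suc n"] e_def Zbar_Suc[OF elim(3)] algebra_simps)
      qed
    qed
    then obtain l where l: "P *v l = l" "x \<longlonglongrightarrow> l" by blast
    define z :: "real^'v" where "z = l + (\<chi> i. 1 / 2)"
    have "(\<lambda>n. x n + (\<chi> i. 1 / 2)) \<longlonglongrightarrow> z" unfolding z_def by (intro tendsto_intros l)
    moreover have "x n + (\<chi> i. 1 / 2) = Zbar n \<omega>" for n by (simp add: x_def vec_eq_iff)
    ultimately have z: "(\<lambda>n. Zbar n \<omega>) \<longlonglongrightarrow> z" by simp
    then have "Zinf \<omega> = z" by (simp add: Zinf_def limI)
    moreover have "(\<chi> j. z $ j - 1 / 2) = l" by (simp add: z_def vec_eq_iff)
    then have "draw_prob A competitive z i = z $ i" for i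
      using drift[of z i] l(1) by (simp add: z_def)
    ultimately show ?case using z by simp
  qed
qed

end

section \<open>Non-degeneracy of the limit\<close>

context interacting_agents
begin

abbreviation \<xi> :: "nat \<Rightarrow> 'v \<Rightarrow> 'a \<Rightarrow> real" where
  "\<xi> n i \<omega> \<equiv> Y (Suc n) \<omega> $ i - p n i \<omega>"

lemma AE_\<xi>_bound: "AE \<omega> in M. \<bar>\<xi> n i \<omega>\<bar> \<le> 1"
  using AE_innovation_bound by eventually_elim simp

lemma AE_p_bound: "AE \<omega> in M. \<bar>p n i \<omega>\<bar> \<le> 1"
  using AE_p_range by eventually_elim (auto simp: abs_le_iff)

lemma AE_Y_bound: "AE \<omega> in M. \<bar>Y n \<omega> $ i\<bar> \<le> 1"
  using AE_space
proof eventually_elim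
  case (elim \<omega>)
  then show ?case using Y_range[OF elim, of n i] by auto
qed

text \<open>Conditional independence makes the expectation of the product of the two draws equal to
  that of \<open>p n i * p n j\<close>; orthogonality of innovations to the past gives the mixed
  terms the same value.\<close>

lemma innovations_uncorrelated:
  assumes indep: "cond_indep_draws M Y" and ij: "i \<noteq> j"
  shows "(\<integral>\<omega>. \<xi> n i \<omega> * \<xi> n j \<omega> \<partial>M) = 0"
proof -
  \<comment> \<open>The product formula concerns all agents at once; the whole line for the others
    reduces it to the factors of \<open>i\<close> and \<open>j\<close>.\<close>
  define B :: "'v \<Rightarrow> real set" where "B k = (if k = i \<or> k = j then {1} else UNIV)" for k
  let ?E = "{\<omega> \<in> space M. \<forall>k. Y (Suc n) \<omega> $ k \<in> B k}"
  let ?c = "\<lambda>k. real_cond_exp M (F n) (indicator {\<omega> \<in> space M. Y (Suc n) \<omega> $ k \<in> B k})"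
  have [measurable]: "{\<omega> \<in> space M. Y (Suc n) \<omega> $ k \<in> B k} \<in> events" for k
    by (cases "k = i \<or> k = j") (auto simp: B_def)
  have E_eq: "?E = {\<omega> \<in> space M. Y (Suc n) \<omega> $ i = 1 \<and> Y (Suc n) \<omega> $ j = 1}"
    by (auto simp: B_def)
  have [measurable]: "?E \<in> events" unfolding E_eq by measurable
  have one: "AE \<omega> in M. ?c k \<omega> = 1" if "k \<noteq> i" "k \<noteq> j" for k
  proof -
    have "{\<omega> \<in> space M. Y (Suc n) \<omega> $ k \<in> B k} = space M" using that by (auto simp: B_def)
    moreover have "AE \<omega> in M. real_cond_exp M (F n) (indicator (space M)) \<omega> = indicator (space M) \<omega>"
      using sets.top[of "F n"]
      by (intro sigma_finite_subalgebra.real_cond_exp_F_meas[OF sigma_finite_history])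
        (auto simp: space_history less_top[symmetric])
    ultimately show ?thesis using AE_space by (auto elim!: eventually_elim2)
  qed
  have "AE \<omega> in M. \<forall>k. k \<noteq> i \<longrightarrow> k \<noteq> j \<longrightarrow> ?c k \<omega> = 1"
    unfolding AE_all_countable using one by auto
  moreover have "AE \<omega> in M. real_cond_exp M (F n) (indicator ?E) \<omega> = (\<Prod>k\<in>UNIV. ?c k \<omega>)"
    using indep unfolding cond_indep_draws_def by (auto simp: B_def)
  ultimately have c: "AE \<omega> in M. real_cond_exp M (F n) (indicator ?E) \<omega> = p n i \<omega> * p n j \<omega>"
  proof eventually_elim
    case (elim \<omega>)
    have "(\<Prod>k\<in>UNIV. ?c k \<omega>) = (\<Prod>k\<in>{i, j}. ?c k \<omega>)"
      using elim(1) by (intro prod.mono_neutral_right) auto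
    also have "\<dots> = p n i \<omega> * p n j \<omega>" using ij by (simp add: p_def B_def)
    finally show ?case using elim(2) by simp
  qed
  have int: "integrable M (\<lambda>\<omega>. Y (Suc n) \<omega> $ i * \<xi> n j \<omega>)" "integrable M (\<lambda>\<omega>. p n i \<omega> * \<xi> n j \<omega>)"
    "integrable M (\<lambda>\<omega>. Y (Suc n) \<omega> $ i * Y (Suc n) \<omega> $ j)" "integrable M (\<lambda>\<omega>. Y (Suc n) \<omega> $ i * p n j \<omega>)"
    "integrable M (\<lambda>\<omega>. p n j \<omega> * \<xi> n i \<omega>)" "integrable M (\<lambda>\<omega>. p n i \<omega> * p n j \<omega>)"
    by (intro integrable_bounded_mult[where b=1 and c=1] AE_\<xi>_bound AE_p_bound AE_Y_bound; measurable)+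
  have "(\<integral>\<omega>. Y (Suc n) \<omega> $ i * Y (Suc n) \<omega> $ j \<partial>M) = (\<integral>\<omega>. indicator ?E \<omega> \<partial>M)"
  proof (intro Bochner_Integration.integral_cong refl)
    fix \<omega> assume "\<omega> \<in> space M"
    then show "Y (Suc n) \<omega> $ i * Y (Suc n) \<omega> $ j = indicator ?E \<omega>"
      using Y_range[of \<omega> "Suc n" i] Y_range[of \<omega> "Suc n" j] unfolding E_eq by (auto simp: indicator_def)
  qed
  also have "\<dots> = (\<integral>\<omega>. real_cond_exp M (F n) (indicator ?E) \<omega> \<partial>M)"
    by (rule sigma_finite_subalgebra.real_cond_exp_int(2)[OF sigma_finite_history, symmetric])
      (simp add: less_top[symmetric])
  also have "\<dots> = (\<integral>\<omega>. p n i \<omega> * p n j \<omega> \<partial>M)"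
    using c by (intro integral_cong_AE) auto
  finally have YY: "(\<integral>\<omega>. Y (Suc n) \<omega> $ i * Y (Suc n) \<omega> $ j \<partial>M) = (\<integral>\<omega>. p n i \<omega> * p n j \<omega> \<partial>M)" .
  have "(\<integral>\<omega>. Y (Suc n) \<omega> $ i * p n j \<omega> - p n i \<omega> * p n j \<omega> \<partial>M) = (\<integral>\<omega>. p n j \<omega> * \<xi> n i \<omega> \<partial>M)"
    by (simp add: algebra_simps)
  also have "\<dots> = 0"
    by (rule innovation_orthogonal[OF p_measurable_history AE_p_bound])
  finally have Yp: "(\<integral>\<omega>. Y (Suc n) \<omega> $ i * p n j \<omega> \<partial>M) = (\<integral>\<omega>. p n i \<omega> * p n j \<omega> \<partial>M)"
    using int by (simp add: Bochner_Integration.integral_diff)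
  have "(\<integral>\<omega>. \<xi> n i \<omega> * \<xi> n j \<omega> \<partial>M)
    = (\<integral>\<omega>. Y (Suc n) \<omega> $ i * Y (Suc n) \<omega> $ j - Y (Suc n) \<omega> $ i * p n j \<omega> - p n i \<omega> * \<xi> n j \<omega> \<partial>M)"
    by (intro Bochner_Integration.integral_cong) (auto simp: algebra_simps)
  also have "\<dots> = (\<integral>\<omega>. Y (Suc n) \<omega> $ i * Y (Suc n) \<omega> $ j \<partial>M) - (\<integral>\<omega>. Y (Suc n) \<omega> $ i * p n j \<omega> \<partial>M)
      - (\<integral>\<omega>. p n i \<omega> * \<xi> n j \<omega> \<partial>M)"
    using int by (simp add: Bochner_Integration.integral_diff)
  also have "(\<integral>\<omega>. p n i \<omega> * \<xi> n j \<omega> \<partial>M) = 0"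
    by (rule innovation_orthogonal[OF p_measurable_history AE_p_bound])
  finally show ?thesis using YY Yp by simp
qed

text \<open>A left null vector \<open>w\<close> of the drift makes \<open>w \<bullet> (Z\<^sub>n - 1/2)\<close> a bounded martingale; if its limit is
  constant, each increment is orthogonal to that limit and hence vanishes.\<close>
lemma constant_limit_imp_increment_zero:
  fixes w :: "'v \<Rightarrow> real"
  assumes w: "\<And>j. (\<Sum>i\<in>UNIV. w i * P $ i $ j) = w j"
    and const: "AE \<omega> in M. (\<Sum>i\<in>UNIV. w i * (Zinf \<omega> $ i - 1 / 2)) = c"
  shows "(\<integral>\<omega>. (\<Sum>i\<in>UNIV. w i * \<xi> k i \<omega>)\<^sup>2 \<partial>M) = 0"
proof -
  define \<eta> where "\<eta> n \<omega> = (\<Sum>i\<in>UNIV. w i * \<xi> n i \<omega>)" for n \<omega>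
  define \<phi> where "\<phi> n \<omega> = (\<Sum>i\<in>UNIV. w i * (Zbar n \<omega> $ i - 1 / 2))" for n \<omega>
  \<comment> \<open>An \<open>F n\<close>-measurable copy of \<open>\<phi> n\<close>: left
    invariance of \<open>w\<close> makes the two equal almost surely. It starts the covariance
    computation, where orthogonality needs a function of the past.\<close>
  define \<psi> where "\<psi> n \<omega> = (\<Sum>i\<in>UNIV. w i * (p n i \<omega> - 1 / 2))" for n \<omega>
  define b where "b = (\<Sum>i\<in>UNIV. \<bar>w i\<bar>)"
  have lin_bound: "\<bar>\<Sum>i\<in>UNIV. w i * y i\<bar> \<le> b" if "\<And>i. \<bar>y i\<bar> \<le> 1" for y
    unfolding b_def
    by (rule order_trans[OF sum_abs sum_mono]) (use that in \<open>simp add: abs_mult mult_left_le\<close>)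
  have [measurable]: "\<eta> n \<in> borel_measurable M" "\<phi> n \<in> borel_measurable M" "\<psi> n \<in> borel_measurable M" for n
    unfolding \<eta>_def[abs_def] \<phi>_def[abs_def] \<psi>_def[abs_def] by measurable
  have \<eta>_F: "\<eta> n \<in> borel_measurable (F m)" if "n < m" for n m
  proof -
    have "sets (F (Suc n)) \<subseteq> sets (F m)"
      using that by (intro lift_Suc_mono_le[where f="\<lambda>n. sets (F n)", OF sets_history_Suc]) simp
    then have "subalgebra (F m) (F (Suc n))" by (simp add: subalgebra_def space_history)
    then show ?thesis unfolding \<eta>_def[abs_def]
      by (intro borel_measurable_sum borel_measurable_times borel_measurable_const
          measurable_from_subalg[OF _ innovation_measurable_history])
  qed
  have \<psi>_F: "\<psi> n \<in> borel_measurable (F n)" for n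
    unfolding \<psi>_def[abs_def] using p_measurable_history by measurable
  have \<eta>_bound: "AE \<omega> in M. \<bar>\<eta> n \<omega>\<bar> \<le> b" for n
    using AE_innovation_bound by eventually_elim (simp add: \<eta>_def lin_bound)
  have \<psi>_bound: "AE \<omega> in M. \<bar>\<psi> n \<omega>\<bar> \<le> b" for n
    using AE_p_range
  proof eventually_elim
    case (elim \<omega>)
    have "\<bar>p n i \<omega> - 1 / 2\<bar> \<le> 1" for i using elim[rule_format, of n i] by (auto simp: abs_le_iff)
    then show ?case by (simp add: \<psi>_def lin_bound)
  qed
  have \<phi>_bound: "AE \<omega> in M. \<bar>\<phi> n \<omega>\<bar> \<le> b" for n
    using AE_space
  proof eventually_elim
    case (elim \<omega>)
    have "\<bar>Zbar n \<omega> $ i - 1 / 2\<bar> \<le> 1" for i using Zbar_range[OF elim, of n i] by (auto simp: abs_le_iff)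
    then show ?case by (simp add: \<phi>_def lin_bound)
  qed
  have \<psi>_\<phi>: "AE \<omega> in M. \<psi> n \<omega> = \<phi> n \<omega>" for n
    using AE_p
  proof eventually_elim
    case (elim \<omega>)
    have "\<psi> n \<omega> = (\<Sum>i\<in>UNIV. \<Sum>j\<in>UNIV. w i * P $ i $ j * (Zbar n \<omega> $ j - 1 / 2))"
      using elim by (simp add: \<psi>_def draw_prob_centred[OF stochastic] sum_distrib_left mult.assoc)
    also have "\<dots> = (\<Sum>j\<in>UNIV. (\<Sum>i\<in>UNIV. w i * P $ i $ j) * (Zbar n \<omega> $ j - 1 / 2))"
      unfolding sum_distrib_right by (rule sum.swap)
    finally show ?case by (simp add: w \<phi>_def)
  qed
  have \<phi>_Suc: "AE \<omega> in M. \<phi> (Suc n) \<omega> = \<phi> n \<omega> + r n * \<eta> n \<omega>" for n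
    using \<psi>_\<phi>[of n] AE_space
  proof eventually_elim
    case (elim \<omega>)
    have "\<phi> (Suc n) \<omega> = (1 - r n) * \<phi> n \<omega> + r n * (\<psi> n \<omega> + \<eta> n \<omega>)"
      unfolding \<phi>_def \<psi>_def \<eta>_def sum_distrib_left sum.distrib[symmetric]
      by (intro sum.cong) (auto simp: Zbar_Suc[OF elim(2)] algebra_simps diff_divide_distrib)
    then show ?case using elim(1) by (simp add: algebra_simps)
  qed
  have orth: "(\<integral>\<omega>. g \<omega> * \<eta> n \<omega> \<partial>M) = 0" if g: "g \<in> borel_measurable (F n)" "AE \<omega> in M. \<bar>g \<omega>\<bar> \<le> b'" for g n b'
  proof -
    have gM: "g \<in> borel_measurable M" using measurable_from_subalg[OF subalgebra_history g(1)] .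
    have int: "integrable M (\<lambda>\<omega>. w i * (g \<omega> * \<xi> n i \<omega>))" for i
      by (intro integrable_mult_right integrable_bounded_mult[OF gM _ g(2) AE_\<xi>_bound]) measurable
    have "(\<integral>\<omega>. g \<omega> * \<eta> n \<omega> \<partial>M) = (\<integral>\<omega>. (\<Sum>i\<in>UNIV. w i * (g \<omega> * \<xi> n i \<omega>)) \<partial>M)"
      by (simp add: \<eta>_def sum_distrib_left mult.left_commute)
    also have "\<dots> = (\<Sum>i\<in>UNIV. w i * (\<integral>\<omega>. g \<omega> * \<xi> n i \<omega> \<partial>M))"
      using int by (simp add: Bochner_Integration.integral_sum)
    also have "\<dots> = 0" by (simp add: innovation_orthogonal[OF g])
    finally show ?thesis .
  qed
  have int_\<eta>\<phi>: "integrable M (\<lambda>\<omega>. \<eta> k \<omega> * \<phi> n \<omega>)" and int_\<eta>\<eta>: "integrable M (\<lambda>\<omega>. \<eta> k \<omega> * \<eta> n \<omega>)" for n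
    by (intro integrable_bounded_mult[where b=b and c=b] \<eta>_bound \<phi>_bound; measurable)+
  have cov_Suc: "(\<integral>\<omega>. \<eta> k \<omega> * \<phi> (Suc n) \<omega> \<partial>M) = (\<integral>\<omega>. \<eta> k \<omega> * \<phi> n \<omega> \<partial>M) + r n * (\<integral>\<omega>. \<eta> k \<omega> * \<eta> n \<omega> \<partial>M)" for n
  proof -
    have "(\<integral>\<omega>. \<eta> k \<omega> * \<phi> (Suc n) \<omega> \<partial>M) = (\<integral>\<omega>. \<eta> k \<omega> * \<phi> n \<omega> + r n * (\<eta> k \<omega> * \<eta> n \<omega>) \<partial>M)"
      using \<phi>_Suc[of n] by (intro integral_cong_AE) (auto elim!: eventually_mono simp: algebra_simps)
    then show ?thesis using int_\<eta>\<phi>[of n] int_\<eta>\<eta>[of n] by simp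
  qed
  \<comment> \<open>Increments after time \<open>k\<close> are orthogonal to
    \<open>\<eta> k\<close>, so the covariance stays at the contribution of the step from
    \<open>k\<close> to \<open>Suc k\<close>.\<close>
  have cov: "(\<integral>\<omega>. \<eta> k \<omega> * \<phi> n \<omega> \<partial>M) = r k * (\<integral>\<omega>. (\<eta> k \<omega>)\<^sup>2 \<partial>M)" if "Suc k \<le> n" for n
    using that
  proof (induction n rule: dec_induct)
    case base
    have "(\<integral>\<omega>. \<eta> k \<omega> * \<phi> k \<omega> \<partial>M) = (\<integral>\<omega>. \<psi> k \<omega> * \<eta> k \<omega> \<partial>M)"
      using \<psi>_\<phi>[of k] by (intro integral_cong_AE) (auto elim!: eventually_mono)
    also have "\<dots> = 0" by (rule orth[OF \<psi>_F \<psi>_bound])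
    finally show ?case unfolding cov_Suc by (simp add: power2_eq_square)
  next
    case (step n)
    have "(\<integral>\<omega>. \<eta> k \<omega> * \<eta> n \<omega> \<partial>M) = 0" by (rule orth[OF \<eta>_F \<eta>_bound]) (use step in simp)
    then show ?case unfolding cov_Suc using step by simp
  qed
  have lim: "(\<lambda>n. \<integral>\<omega>. \<eta> k \<omega> * \<phi> n \<omega> \<partial>M) \<longlonglongrightarrow> (\<integral>\<omega>. \<eta> k \<omega> * c \<partial>M)"
  proof (rule integral_dominated_convergence[where w="\<lambda>_. b * b"])
    show "AE \<omega> in M. (\<lambda>n. \<eta> k \<omega> * \<phi> n \<omega>) \<longlonglongrightarrow> \<eta> k \<omega> * c"
      using AE_convergence const
    proof eventually_elim
      case (elim \<omega>)
      have "(\<lambda>n. \<phi> n \<omega>) \<longlonglongrightarrow> (\<Sum>i\<in>UNIV. w i * (Zinf \<omega> $ i - 1 / 2))"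
        unfolding \<phi>_def using elim(1) by (intro tendsto_intros) auto
      then show ?case using elim(2) by (intro tendsto_mult tendsto_const) simp
    qed
    show "AE \<omega> in M. norm (\<eta> k \<omega> * \<phi> n \<omega>) \<le> b * b" for n
      using \<eta>_bound[of k] \<phi>_bound[of n] by eventually_elim (simp add: abs_mult mult_mono')
  qed auto
  have "(\<integral>\<omega>. \<eta> k \<omega> * c \<partial>M) = 0"
    using orth[of "\<lambda>_. c" k "\<bar>c\<bar>"] by (simp add: mult.commute)
  with lim have "(\<lambda>n. \<integral>\<omega>. \<eta> k \<omega> * \<phi> n \<omega> \<partial>M) \<longlonglongrightarrow> 0" by (simp only:)
  moreover have "\<forall>\<^sub>F n in sequentially. (\<integral>\<omega>. \<eta> k \<omega> * \<phi> n \<omega> \<partial>M) = r k * (\<integral>\<omega>. (\<eta> k \<omega>)\<^sup>2 \<partial>M)"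
    using eventually_ge_at_top[of "Suc k"] by eventually_elim (rule cov)
  ultimately have "(\<lambda>n. r k * (\<integral>\<omega>. (\<eta> k \<omega>)\<^sup>2 \<partial>M)) \<longlonglongrightarrow> 0"
    by (rule Lim_transform_eventually)
  then have "r k * (\<integral>\<omega>. (\<eta> k \<omega>)\<^sup>2 \<partial>M) = 0" by (simp add: LIMSEQ_const_iff)
  moreover have "r k \<noteq> 0" using step_range[of k] by simp
  ultimately show ?thesis by (simp add: \<eta>_def)
qed

text \<open>Without correlation the second moment is a sum of nonnegative diagonal terms, so
  innovations cannot cancel one another and each one with nonzero weight vanishes.\<close>

lemma uncorrelated_sum_zero:
  assumes indep: "cond_indep_draws M Y"
    and zero: "(\<integral>\<omega>. (\<Sum>i\<in>UNIV. w i * \<xi> n i \<omega>)\<^sup>2 \<partial>M) = 0" and w: "w j \<noteq> 0"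
  shows "AE \<omega> in M. \<xi> n j \<omega> = 0"
proof -
  have int: "integrable M (\<lambda>\<omega>. \<xi> n i \<omega> * \<xi> n k \<omega>)" for i k
    by (intro integrable_bounded_mult[where b=1 and c=1] AE_\<xi>_bound; measurable)
  have "(\<integral>\<omega>. (\<Sum>i\<in>UNIV. w i * \<xi> n i \<omega>)\<^sup>2 \<partial>M)
    = (\<integral>\<omega>. (\<Sum>i\<in>UNIV. \<Sum>k\<in>UNIV. w i * w k * (\<xi> n i \<omega> * \<xi> n k \<omega>)) \<partial>M)"
    by (intro Bochner_Integration.integral_cong)
      (auto simp: power2_eq_square sum_product intro!: sum.cong)
  also have "\<dots> = (\<Sum>i\<in>UNIV. \<Sum>k\<in>UNIV. w i * w k * (\<integral>\<omega>. \<xi> n i \<omega> * \<xi> n k \<omega> \<partial>M))"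
    using int by (simp add: Bochner_Integration.integral_sum)
  also have "\<dots> = (\<Sum>i\<in>UNIV. \<Sum>k\<in>UNIV. if i = k then w i * w i * (\<integral>\<omega>. \<xi> n i \<omega> * \<xi> n i \<omega> \<partial>M) else 0)"
    using innovations_uncorrelated[OF indep] by (intro sum.cong) auto
  also have "\<dots> = (\<Sum>i\<in>UNIV. w i * w i * (\<integral>\<omega>. \<xi> n i \<omega> * \<xi> n i \<omega> \<partial>M))" by simp
  finally have "(\<Sum>i\<in>UNIV. w i * w i * (\<integral>\<omega>. \<xi> n i \<omega> * \<xi> n i \<omega> \<partial>M)) = 0" using zero by simp
  moreover have nonneg: "0 \<le> w i * w i * (\<integral>\<omega>. \<xi> n i \<omega> * \<xi> n i \<omega> \<partial>M)" for i
    by (intro mult_nonneg_nonneg[OF zero_le_square] Bochner_Integration.integral_nonneg zero_le_square)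
  ultimately have "w j * w j * (\<integral>\<omega>. \<xi> n j \<omega> * \<xi> n j \<omega> \<partial>M) = 0"
    using sum_nonneg_eq_0_iff[of UNIV "\<lambda>i. w i * w i * (\<integral>\<omega>. \<xi> n i \<omega> * \<xi> n i \<omega> \<partial>M)", OF finite nonneg]
    by simp
  then have "(\<integral>\<omega>. \<xi> n j \<omega> * \<xi> n j \<omega> \<partial>M) = 0"
    using w by (simp only: mult_eq_0_iff simp_thms)
  then have "AE \<omega> in M. \<xi> n j \<omega> * \<xi> n j \<omega> = 0"
    by (subst (asm) integral_nonneg_eq_0_iff_AE[OF int]) auto
  then show ?thesis by eventually_elim simp
qed

text \<open>If the draws are deterministic then all draw probabilities are \<open>0\<close> or \<open>1\<close>, so every agent that
  influences \<open>R\<close> sits at an extreme value, and a step of size \<open>r\<^sub>n \<in> (0, 1)\<close> between extreme values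
  cannot move it.\<close>
lemma closed_class_nondegenerate:
  fixes X :: "'a \<Rightarrow> real"
  assumes indep: "cond_indep_draws M Y" and R: "R \<in> level_classes A 0"
    and \<sigma>: "\<And>i. i \<in> R \<Longrightarrow> \<sigma> i = 1 \<or> \<sigma> i = (-1::real)"
    and P_R: "\<And>i j. i \<in> R \<Longrightarrow> j \<in> R \<Longrightarrow> P $ i $ j = \<sigma> i * \<sigma> j * A $ i $ j"
    and X: "X \<in> borel_measurable M"
    and limit: "AE \<omega> in M. \<forall>i\<in>R. Zinf \<omega> $ i - 1 / 2 = \<sigma> i * (X \<omega> - 1 / 2)"
    and not_frozen: "\<not> frozen_start M A competitive Zbar R"
  shows "prob {\<omega> \<in> space M. X \<omega> = x} < 1"
proof (rule ccontr)
  assume "\<not> ?thesis"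
  then have "prob {\<omega> \<in> space M. X \<omega> = x} = 1" using prob_le_1 by (simp add: not_less antisym)
  moreover have "{\<omega> \<in> space M. X \<omega> = x} \<in> events" using X by measurable
  ultimately have X_const: "AE \<omega> in M. X \<omega> = x" by (simp add: prob_Collect_eq_1)
  have closed: "A $ i $ j = 0" if "i \<in> R" "j \<notin> R" for i j using R that by auto
  obtain \<pi> where \<pi>: "\<And>i. i \<in> R \<Longrightarrow> \<pi> i > 0" "\<And>j. j \<in> R \<Longrightarrow> (\<Sum>i\<in>R. \<pi> i * A $ i $ j) = \<pi> j"
    using closed_class_stationary[OF stochastic R] by blast
  \<comment> \<open>On \<open>R\<close> the matrix \<open>P\<close> is \<open>A\<close> conjugated
    by the signs, so \<open>\<sigma> i * \<pi> i\<close> is a left fixed vector there; it extends by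
    0 because agents of \<open>R\<close> give no weight outside \<open>R\<close>.\<close>
  define w where "w i = (if i \<in> R then \<sigma> i * \<pi> i else 0)" for i
  have w_R: "(\<Sum>i\<in>UNIV. w i * f i) = (\<Sum>i\<in>R. \<sigma> i * \<pi> i * f i)" for f
  proof -
    have "(\<Sum>i\<in>UNIV. w i * f i) = (\<Sum>i\<in>R. w i * f i)"
      by (intro sum.mono_neutral_right) (auto simp: w_def)
    then show ?thesis by (simp add: w_def)
  qed
  have w: "(\<Sum>i\<in>UNIV. w i * P $ i $ j) = w j" for j
  proof (cases "j \<in> R")
    case True
    have "\<sigma> i * \<pi> i * P $ i $ j = \<sigma> j * (\<pi> i * A $ i $ j)" if "i \<in> R" for i
      using \<sigma>[OF that] P_R[OF that True] by auto
    then have "(\<Sum>i\<in>R. \<sigma> i * \<pi> i * P $ i $ j) = \<sigma> j * (\<Sum>i\<in>R. \<pi> i * A $ i $ j)"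
      unfolding sum_distrib_left by (rule sum.cong[OF refl])
    then show ?thesis using True \<pi>(2)[OF True] by (simp add: w_R) (simp add: w_def)
  next
    case False
    then have "P $ i $ j = 0" if "i \<in> R" for i using closed[OF that False] by (simp add: interaction_def)
    then show ?thesis using False by (simp add: w_R) (simp add: w_def)
  qed
  have "AE \<omega> in M. (\<Sum>i\<in>UNIV. w i * (Zinf \<omega> $ i - 1 / 2)) = (\<Sum>i\<in>R. \<sigma> i * \<pi> i * (\<sigma> i * (x - 1 / 2)))"
    using limit X_const by eventually_elim (simp add: w_R)
  note zero = constant_limit_imp_increment_zero[OF w this]
  have "AE \<omega> in M. \<xi> n i \<omega> = 0" if "i \<in> R" for n i
  proof (rule uncorrelated_sum_zero[OF indep zero])
    show "w i \<noteq> 0" using that \<pi>(1)[OF that] \<sigma>[OF that] by (auto simp: w_def)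
  qed
  then have "AE \<omega> in M. \<forall>n i. i \<in> R \<longrightarrow> \<xi> n i \<omega> = 0" by (auto simp: AE_all_countable)
  then have frozen: "AE \<omega> in M. \<forall>i\<in>R. Zbar 0 \<omega> $ i \<in> {0, 1} \<and> draw_prob A competitive (Zbar 0 \<omega>) i = Zbar 0 \<omega> $ i
      \<and> Zbar 0 \<omega> $ i = 1 / 2 + \<sigma> i * (x - 1 / 2)"
    using AE_p AE_convergence limit X_const AE_space
  proof eventually_elim
    case (elim \<omega>)
    have draw: "draw_prob A competitive (Zbar n \<omega>) i = Y (Suc n) \<omega> $ i" if "i \<in> R" for n i
      using elim(1,2) that by simp
    have extreme: "Zbar n \<omega> $ j \<in> {0, 1}" if j: "j \<in> R" for n j
    proof -
      \<comment> \<open>Since \<open>\<pi> j > 0\<close>, stationarity provides an agent, possibly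
        \<open>j\<close> itself, that gives weight to \<open>j\<close>. Its draw probability is an
        average equal to 0 or 1, so all values averaged with positive weight are that same
        extreme.\<close>
      have "\<exists>i\<in>R. A $ i $ j \<noteq> 0"
      proof (rule ccontr)
        assume "\<not> ?thesis"
        then have "(\<Sum>i\<in>R. \<pi> i * A $ i $ j) = 0" by (intro sum.neutral) simp
        then show False using \<pi>[OF j] by simp
      qed
      then obtain i where i: "i \<in> R" "A $ i $ j \<noteq> 0" by blast
      define y where "y k = (if competitive i \<and> k \<noteq> i then 1 - Zbar n \<omega> $ k else Zbar n \<omega> $ k)" for k
      have y: "0 \<le> y k" "y k \<le> 1" for k using Zbar_range[OF elim(6), of n k] by (auto simp: y_def)
      have nn: "0 \<le> A $ i $ k" for k by (rule stochastic_matrix_nonneg[OF stochastic])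
      have dp: "draw_prob A competitive (Zbar n \<omega>) i = (\<Sum>k\<in>UNIV. A $ i $ k * y k)"
        unfolding draw_prob_def by (subst sum.remove[of UNIV i]) (auto simp: y_def intro!: sum.cong)
      have "y j \<in> {0, 1}"
      proof (cases "Y (Suc n) \<omega> $ i = 0")
        case True
        then have "(\<Sum>k\<in>UNIV. A $ i $ k * y k) = 0" using draw[OF i(1), of n] dp by simp
        then have "A $ i $ j * y j = 0"
          using sum_nonneg_eq_0_iff[of UNIV "\<lambda>k. A $ i $ k * y k", OF finite mult_nonneg_nonneg[OF nn y(1)]] by simp
        then show ?thesis using i(2) by simp
      next
        case False
        then have "(\<Sum>k\<in>UNIV. A $ i $ k * y k) = 1"
          using draw[OF i(1), of n] dp Y_range[OF elim(6), of "Suc n" i] by simp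
        then have "(\<Sum>k\<in>UNIV. A $ i $ k * (1 - y k)) = 0"
          using stochastic_matrix_row_sum[OF stochastic, of i] by (simp add: right_diff_distrib sum_subtractf)
        moreover have "0 \<le> A $ i $ k * (1 - y k)" for k using nn[of k] y(2)[of k] by simp
        ultimately have "A $ i $ j * (1 - y j) = 0"
          using sum_nonneg_eq_0_iff[of UNIV "\<lambda>k. A $ i $ k * (1 - y k)", OF finite] by simp
        then show ?thesis using i(2) by simp
      qed
      then show ?thesis by (auto simp: y_def split: if_splits)
    qed
    \<comment> \<open>From 0 the next state is \<open>r n * Y\<close>, from 1 it is
      \<open>1 - r n + r n * Y\<close>; with \<open>0 < r n < 1\<close>, an extreme next state
      forces the draw to repeat the current one.\<close>
    have step: "Zbar (Suc n) \<omega> $ i = Zbar n \<omega> $ i \<and> Y (Suc n) \<omega> $ i = Zbar n \<omega> $ i" if i: "i \<in> R" for n i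
      using extreme[OF i, of n] extreme[OF i, of "Suc n"] Y_range[OF elim(6), of "Suc n" i]
        step_range[of n] Zbar_Suc[OF elim(6), of n i] by auto
    have const: "Zbar n \<omega> $ i = Zbar 0 \<omega> $ i" if "i \<in> R" for n i
      by (induction n) (use step[OF that] in auto)
    have "Zinf \<omega> $ i = Zbar 0 \<omega> $ i" if i: "i \<in> R" for i
    proof (rule LIMSEQ_unique)
      show "(\<lambda>n. Zbar n \<omega> $ i) \<longlonglongrightarrow> Zinf \<omega> $ i" using elim(3) by (intro tendsto_intros) auto
      show "(\<lambda>n. Zbar n \<omega> $ i) \<longlonglongrightarrow> Zbar 0 \<omega> $ i"
        by (rule tendsto_eventually) (use const[OF i] in simp)
    qed
    moreover have "Zinf \<omega> $ i = 1 / 2 + \<sigma> i * (x - 1 / 2)" if "i \<in> R" for i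
      using elim(4,5) that by (metis add_diff_cancel_left' diff_add_cancel add.commute)
    ultimately show ?case using extreme[of _ 0] draw[of _ 0] step[of _ 0] by auto
  qed
  \<comment> \<open>The constant limit makes the initial configuration on \<open>R\<close>
    deterministic. The same formula is used off \<open>R\<close>, which the draws of a closed class
    never read.\<close>
  define z :: "real^'v" where "z = (\<chi> i. 1 / 2 + \<sigma> i * (x - 1 / 2))"
  have "AE \<omega> in M. (\<forall>i\<in>R. z $ i \<in> {0, 1} \<and> draw_prob A competitive z i = z $ i)"
    using frozen
  proof eventually_elim
    case (elim \<omega>)
    then have z: "z $ i = Zbar 0 \<omega> $ i" if "i \<in> R" for i using that by (simp add: z_def)
    have dp: "draw_prob A competitive z i = draw_prob A competitive (Zbar 0 \<omega>) i" if i: "i \<in> R" for i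
    proof -
      have eq: "A $ i $ k * (if competitive i then 1 - z $ k else z $ k)
        = A $ i $ k * (if competitive i then 1 - Zbar 0 \<omega> $ k else Zbar 0 \<omega> $ k)" for k
        using z[of k] closed[OF i, of k] by (cases "k \<in> R") auto
      show ?thesis unfolding draw_prob_def z[OF i] eq ..
    qed
    show ?case
    proof (intro ballI conjI)
      fix i assume i: "i \<in> R"
      show "z $ i \<in> {0, 1}" unfolding z[OF i] using elim i by blast
      show "draw_prob A competitive z i = z $ i" unfolding dp[OF i] unfolding z[OF i] using elim i by blast
    qed
  qed
  moreover have "AE \<omega> in M. \<forall>i\<in>R. Zbar 0 \<omega> $ i = z $ i"
    using frozen by eventually_elim (simp add: z_def)
  ultimately have "frozen_start M A competitive Zbar R"
    unfolding frozen_start_def by auto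
  with not_frozen show False by simp
qed

end

section \<open>The limit, class by class\<close>

theorem theorem3p2:
  fixes M :: "'a measure"
    and A :: "real^'v^'v"
    and r :: "nat \<Rightarrow> real"
    and competitive :: "'v \<Rightarrow> bool"
    and Zbar Y :: "nat \<Rightarrow> 'a \<Rightarrow> real^'v"
  assumes model: "interacting_agents M A r competitive Zbar Y"
    and same_attitude: "\<forall>m. \<forall>T\<in>level_classes A m.
          (\<forall>i\<in>T. \<not> competitive i) \<or> (\<forall>i\<in>T. competitive i)"
  shows "\<exists>Zinf. Zinf \<in> borel_measurable M
    \<and> (AE \<omega> in M. (\<lambda>n. Zbar n \<omega>) \<longlonglongrightarrow> Zinf \<omega>)
    \<and> (\<forall>R\<in>level_classes A 0. (\<forall>i\<in>R. \<not> competitive i) \<longrightarrow>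
        (\<exists>X\<in>borel_measurable M.
          (AE \<omega> in M. \<forall>i\<in>R. Zinf \<omega> $ i = X \<omega>)
          \<and> (cond_indep_draws M Y \<and> \<not> frozen_start M A competitive Zbar R \<longrightarrow>
              (\<forall>x\<in>{0..1::real}. measure M {\<omega> \<in> space M. X \<omega> = x} < 1))))
    \<and> (\<forall>R\<in>level_classes A 0. (\<forall>i\<in>R. competitive i) \<longrightarrow>
        (\<forall>V1 V2. bipartition R (edges A \<inter> R \<times> R) V1 V2 \<longrightarrow>
          (\<exists>X\<in>borel_measurable M.
            (AE \<omega> in M. (\<forall>i\<in>V1. Zinf \<omega> $ i = X \<omega>) \<and> (\<forall>i\<in>V2. Zinf \<omega> $ i = 1 - X \<omega>))
            \<and> (cond_indep_draws M Y \<and> \<not> frozen_start M A competitive Zbar R \<longrightarrow>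
                (\<forall>x\<in>{0..1::real}. measure M {\<omega> \<in> space M. X \<omega> = x} < 1)))))
    \<and> (\<forall>R\<in>level_classes A 0. (\<forall>i\<in>R. competitive i) \<longrightarrow> 2 \<le> card R \<longrightarrow>
        \<not> bipartite R (edges A \<inter> R \<times> R) \<longrightarrow>
          (AE \<omega> in M. \<forall>i\<in>R. Zinf \<omega> $ i = 1 / 2))
    \<and> (\<forall>m\<ge>1. \<forall>T\<in>level_classes A m. \<forall>cmp. (\<forall>i\<in>T. competitive i = cmp) \<longrightarrow>
        (\<exists>L. block_inverse T (K_matrix cmp A) L
          \<and> (AE \<omega> in M. \<forall>i\<in>T. Zinf \<omega> $ i =
               - (\<Sum>j\<in>T. L $ i $ j *
                   (c_vector cmp A $ j
                    + (\<Sum>R\<in>level_classes A 0. block_mult (B_tilde cmp A) R (Zinf \<omega>) j)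
                    + (\<Sum>t\<in>{1..<m}. \<Sum>S\<in>level_classes A t.
                        block_mult (B_tilde cmp A) S (Zinf \<omega>) j))))))"
proof -
  interpret interacting_agents M A r competitive Zbar Y by (rule model)
  have equil: "AE \<omega> in M. equilibrium A competitive (Zinf \<omega>)"
    using AE_convergence by eventually_elim (simp add: equilibrium_def stochastic)
  have nth [measurable]: "(\<lambda>\<omega>. Zinf \<omega> $ i) \<in> borel_measurable M" for i
    using measurable_compose[OF Zinf_measurable borel_measurable_nth] .
  show ?thesis
  proof (intro exI[of _ Zinf] conjI ballI allI impI)
    show "Zinf \<in> borel_measurable M" by (rule Zinf_measurable)
    show "AE \<omega> in M. (\<lambda>n. Zbar n \<omega>) \<longlonglongrightarrow> Zinf \<omega>" using AE_convergence by eventually_elim simp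
  next
    fix R assume R: "R \<in> level_classes A 0" and coop: "\<forall>i\<in>R. \<not> competitive i"
    obtain i where i: "i \<in> R" using level_class_nonempty[OF R] by auto
    have lim: "AE \<omega> in M. \<forall>j\<in>R. Zinf \<omega> $ j = Zinf \<omega> $ i"
      using equil by eventually_elim (use equilibrium.cooperative_closed_const[OF _ R coop] i in blast)
    show "\<exists>X\<in>borel_measurable M. (AE \<omega> in M. \<forall>i\<in>R. Zinf \<omega> $ i = X \<omega>)
        \<and> (cond_indep_draws M Y \<and> \<not> frozen_start M A competitive Zbar R \<longrightarrow>
            (\<forall>x\<in>{0..1::real}. prob {\<omega> \<in> space M. X \<omega> = x} < 1))"
    proof (intro bexI[OF _ nth[of i]] conjI impI ballI)
      show "AE \<omega> in M. \<forall>j\<in>R. Zinf \<omega> $ j = Zinf \<omega> $ i" by (rule lim)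
      fix x :: real assume "cond_indep_draws M Y \<and> \<not> frozen_start M A competitive Zbar R"
      then show "prob {\<omega> \<in> space M. Zinf \<omega> $ i = x} < 1"
      proof (elim conjE, intro closed_class_nondegenerate[where \<sigma>="\<lambda>_. 1" and R=R])
        show "AE \<omega> in M. \<forall>j\<in>R. Zinf \<omega> $ j - 1 / 2 = 1 * (Zinf \<omega> $ i - 1 / 2)"
          using lim by eventually_elim simp
      qed (use R coop in \<open>auto simp: interaction_def\<close>)
    qed
  next
    fix R V1 V2 assume R: "R \<in> level_classes A 0" and comp: "\<forall>i\<in>R. competitive i"
      and bip: "bipartition R (edges A \<inter> R \<times> R) V1 V2"
    obtain i where i: "i \<in> V1" using bip by (auto simp: bipartition_def)
    have V: "V1 \<inter> V2 = {}" "V1 \<union> V2 = R"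
      "\<And>k l. (k, l) \<in> edges A \<Longrightarrow> k \<in> R \<Longrightarrow> l \<in> R \<Longrightarrow> (k \<in> V1 \<and> l \<in> V2) \<or> (k \<in> V2 \<and> l \<in> V1)"
      using bip by (auto simp: bipartition_def)
    have lim: "AE \<omega> in M. (\<forall>j\<in>V1. Zinf \<omega> $ j = Zinf \<omega> $ i) \<and> (\<forall>j\<in>V2. Zinf \<omega> $ j = 1 - Zinf \<omega> $ i)"
      using equil by eventually_elim (use equilibrium.competitive_closed_bipartite[OF _ R comp bip i] in blast)
    show "\<exists>X\<in>borel_measurable M. (AE \<omega> in M. (\<forall>i\<in>V1. Zinf \<omega> $ i = X \<omega>) \<and> (\<forall>i\<in>V2. Zinf \<omega> $ i = 1 - X \<omega>))
        \<and> (cond_indep_draws M Y \<and> \<not> frozen_start M A competitive Zbar R \<longrightarrow>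
            (\<forall>x\<in>{0..1::real}. prob {\<omega> \<in> space M. X \<omega> = x} < 1))"
    proof (rule bexI[OF _ nth[of i]], rule conjI[OF lim], intro impI ballI)
      fix x :: real assume *: "cond_indep_draws M Y \<and> \<not> frozen_start M A competitive Zbar R"
      \<comment> \<open>The sign of the side: an edge joins the two sides, so its reversed weight is
        \<open>A $ k $ l\<close> times both signs, while on the diagonal the signs cancel and the
        weight is not reversed.\<close>
      let ?\<sigma> = "\<lambda>j. if j \<in> V1 then 1 else - 1 :: real"
      show "prob {\<omega> \<in> space M. Zinf \<omega> $ i = x} < 1"
      proof (rule closed_class_nondegenerate[where \<sigma>="?\<sigma>" and R=R])
        show "AE \<omega> in M. \<forall>j\<in>R. Zinf \<omega> $ j - 1 / 2 = ?\<sigma> j * (Zinf \<omega> $ i - 1 / 2)"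
          using lim
        proof eventually_elim
          case (elim \<omega>)
          show ?case
          proof
            fix j assume "j \<in> R"
            then consider "j \<in> V1" | "j \<in> V2" "j \<notin> V1" using V(1,2) by blast
            then show "Zinf \<omega> $ j - 1 / 2 = ?\<sigma> j * (Zinf \<omega> $ i - 1 / 2)"
              by cases (use elim in simp_all)
          qed
        qed
        fix k l assume kl: "k \<in> R" "l \<in> R"
        show "P $ k $ l = ?\<sigma> k * ?\<sigma> l * A $ k $ l"
        proof (cases "(k, l) \<in> edges A")
          case True
          have "?\<sigma> k * ?\<sigma> l = - 1" using V(1) V(3)[OF True kl] by (auto simp: disjoint_iff)
          then show ?thesis using True comp kl by (simp add: interaction_def edges_def)
        next
          case False
          then show ?thesis by (auto simp: interaction_def edges_def)
        qed
      qed (use R * in auto)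
    qed
  next
    fix R assume R: "R \<in> level_classes A 0" "\<forall>i\<in>R. competitive i" "2 \<le> card R"
      "\<not> bipartite R (edges A \<inter> R \<times> R)"
    show "AE \<omega> in M. \<forall>i\<in>R. Zinf \<omega> $ i = 1 / 2"
      using equil by eventually_elim (intro ballI equilibrium.competitive_closed_not_bipartite[OF _ R])
  next
    fix m :: nat and T cmp
    assume m: "1 \<le> m" and T: "T \<in> level_classes A m" and cmp: "\<forall>i\<in>T. competitive i = cmp"
    obtain L where L: "block_inverse T (K_matrix cmp A) L"
      using level_class_block_inverse[OF stochastic T m] by blast
    show "\<exists>L. block_inverse T (K_matrix cmp A) L
        \<and> (AE \<omega> in M. \<forall>i\<in>T. Zinf \<omega> $ i =
             - (\<Sum>j\<in>T. L $ i $ j *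
                 (c_vector cmp A $ j
                  + (\<Sum>R\<in>level_classes A 0. block_mult (B_tilde cmp A) R (Zinf \<omega>) j)
                  + (\<Sum>t\<in>{1..<m}. \<Sum>S\<in>level_classes A t.
                      block_mult (B_tilde cmp A) S (Zinf \<omega>) j))))"
    proof (intro exI[of _ L] conjI L)
      show "AE \<omega> in M. \<forall>i\<in>T. Zinf \<omega> $ i =
             - (\<Sum>j\<in>T. L $ i $ j *
                 (c_vector cmp A $ j
                  + (\<Sum>R\<in>level_classes A 0. block_mult (B_tilde cmp A) R (Zinf \<omega>) j)
                  + (\<Sum>t\<in>{1..<m}. \<Sum>S\<in>level_classes A t.
                      block_mult (B_tilde cmp A) S (Zinf \<omega>) j)))"
        using equil by eventually_elim (intro ballI equilibrium.transient_class_equation[OF _ T m cmp L])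
    qed
  qed
qed

end
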